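(* Let $0<\varepsilon\le r$ be constants, let $A\in\mathbb{R}^{n\times n}$, $B\in\mathbb{R}^{n\times m}$, $k\in\mathbb{R}^{m\times n}$, and suppose that $A+Bk$ is Hurwitz. Let $\Theta,\lambda>0$ be constants satisfying $|\exp((A+Bk)t)|\le \Theta e^{-\lambda t}$ for all $t\ge 0$. Consider the closed-loop system $$\dot x(t)=Ax(t)+Bu(t-r-\varepsilon d(t)),\quad \text{for almost all } t\ge 0,$$ $$u(t)=k\exp(Ar)x(t)+k\int_t^{t+r}\exp(A(t+r-s))\,B\,u(s-r)\,ds,\quad t\ge 0,$$ with $x(t)\in\mathbb{R}^n$, $u(t)\in\mathbb{R}^m$, $d(t)\in[-1,1]$. Suppose that $$\Theta\,|\exp(Ar)Bk|\left(e^{|A+Bk|\varepsilon}-e^{-\lambda\varepsilon}\right)<\lambda .$$ Then there exist constants $Q,\sigma>0$ such that for all $d\in L^\infty(\mathbb{R}_+;[-1,1])$, all $x_0\in\mathbb{R}^n$, and all $u_0\in C^0([-r-\varepsilon,0];\mathbb{R}^m)$ with $u_0(0)=k\exp(Ar)x_0+k\int_{-r}^0\exp(-As)Bu_0(s)\,ds$, the solution $(x(t),u(t))\in\mathbb{R}^n\times\mathbb{R}^m$ of the closed-loop system with initial condition $x(0)=x_0$, $u(t)=u_0(t)$ for $t\in[-r-\varepsilon,0]$ satisfies $$|x(t)|+\max_{t-\varepsilon-r\le s\le t}|u(s)|\le Q\exp(-\sigma t)\left(|x_0|+\max_{-\varepsilon-r\le s\le 0}|u_0(s)|\right),\quad\forall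 t\ge 0 .$$ Moreover, if $n=1$, then the hypothesis $\Theta|\exp(Ar)Bk|(e^{|A+Bk|\varepsilon}-e^{-\lambda\varepsilon})<\lambda$ can be replaced by the inequality $$2\,|Bk|\exp(Ar)\left(1-e^{-|A+Bk|\varepsilon}\right)<|A+Bk| ,$$ i.e. for $n=1$, if $2|Bk|\exp(Ar)(1-e^{-|A+Bk|\varepsilon})<|A+Bk|$, then there exist constants $Q,\sigma>0$ such that for all $d\in L^\infty(\mathbb{R}_+;[-1,1])$, all $x_0\in\mathbb{R}^n$, and all $u_0\in C^0([-r-\varepsilon,0];\mathbb{R}^m)$ with $u_0(0)=k\exp(Ar)x_0+k\int_{-r}^0\exp(-As)Bu_0(s)\,ds$, the solution of the closed-loop system with initial condition $x(0)=x_0$, $u(t)=u_0(t)$ for $t\in[-r-\varepsilon,0]$ satisfies $|x(t)|+\max_{t-\varepsilon-r\le s\le t}|u(s)|\le Q\exp(-\sigma t)\left(|x_0|+\max_{-\varepsilon-r\le s\le 0}|u_0(s)|\right)$ for all $t\ge 0$.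
   Context: $\mathbb{R}_+$ is the set of non-negative reals. $|\cdot|$ denotes the Euclidean norm of a vector and the induced (operator) norm $|M|=\sup\{|Mx|:|x|=1\}$ of a real matrix $M$. A square matrix is Hurwitz if all its eigenvalues have negative real parts. $L^\infty(I;U)$ is the space of measurable, essentially bounded functions on the interval $I$ with values in $U$; $C^0(I;U)$ is the space of continuous functions from $I$ to $U$. A solution is a pair with $x$ locally absolutely continuous on $[0,\infty)$, satisfying the differential equation for almost all $t\ge0$, and $u\in C^0([-r-\varepsilon,\infty);\mathbb{R}^m)$ satisfying the feedback equation for all $t\ge0$; the compatibility condition on $u_0(0)$ guarantees that a unique solution exists for all $t\ge 0$. *)

theory Defs
  imports "HOL-Analysis.Analysis"
begin

primrec matpow :: "real ^ 'n ^ 'n \<Rightarrow> nat \<Rightarrow> real ^ 'n ^ 'n" where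
  "matpow M 0 = mat 1"
| "matpow M (Suc j) = M ** matpow M j"

(* The library's exp does not apply to matrices: the type real^'n^'n carries the componentwise
   product and is not a Banach algebra. *)
definition matexp :: "real ^ 'n ^ 'n \<Rightarrow> real ^ 'n ^ 'n" where
  "matexp M = (\<Sum>j. (1 / fact j) *\<^sub>R matpow M j)"

(* The norm class on real^'m^'n is the Frobenius norm, so the induced norm is taken through onorm. *)
definition opnorm :: "real ^ 'm ^ 'n \<Rightarrow> real" where
  "opnorm M = onorm (\<lambda>v. M *v v)"

(* Eigenvalues of a real matrix are complex. *)
definition hurwitz :: "real ^ 'n ^ 'n \<Rightarrow> bool" where
  "hurwitz M \<longleftrightarrow>
     (\<forall>(z :: complex) (v :: complex ^ 'n).
        v \<noteq> 0 \<and> map_matrix complex_of_real M *v v = z *s v \<longrightarrow> Re z < 0)"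

(* Representatives of classes in L^infinity(I; U), with values in U at every point of I. *)
definition Linfty :: "real set \<Rightarrow> 'a::euclidean_space set \<Rightarrow> (real \<Rightarrow> 'a) set" where
  "Linfty I U = {f. f \<in> borel_measurable (lebesgue_on I) \<and>
                    (\<exists>C. AE t in lebesgue_on I. norm (f t) \<le> C) \<and>
                    (\<forall>t\<in>I. f t \<in> U)}"

(* D is a finite family of intervals, each given by its pair of endpoints. *)
definition abs_continuous_on :: "real set \<Rightarrow> (real \<Rightarrow> 'a::real_normed_vector) \<Rightarrow> bool" where
  "abs_continuous_on S f \<longleftrightarrow>
     (\<forall>e>0. \<exists>\<delta>>0. \<forall>D :: (real \<times> real) set.
        finite D \<and> (\<forall>(a, b)\<in>D. a < b \<and> {a..b} \<subseteq> S) \<and>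
        disjoint_family_on (\<lambda>(a, b). {a<..<b}) D \<and>
        (\<Sum>(a, b)\<in>D. b - a) < \<delta>
        \<longrightarrow> (\<Sum>(a, b)\<in>D. norm (f b - f a)) < e)"

definition locally_abs_continuous_on :: "real set \<Rightarrow> (real \<Rightarrow> 'a::real_normed_vector) \<Rightarrow> bool" where
  "locally_abs_continuous_on S f \<longleftrightarrow>
     (\<forall>a b. a \<le> b \<and> {a..b} \<subseteq> S \<longrightarrow> abs_continuous_on {a..b} f)"

(* x matters only on [0, \<infinity>) and u only on [-r-\<epsilon>, \<infinity>); since the differential equation is required
   for almost all t, the two-sided derivative at t = 0 is immaterial. *)
definition closed_loop_solution ::
  "real ^ 'n ^ 'n \<Rightarrow> real ^ 'm ^ 'n \<Rightarrow> real ^ 'n ^ 'm \<Rightarrow> real \<Rightarrow> real \<Rightarrow> (real \<Rightarrow> real) \<Rightarrow>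
   (real \<Rightarrow> real ^ 'n) \<Rightarrow> (real \<Rightarrow> real ^ 'm) \<Rightarrow> bool" where
  "closed_loop_solution A B k r \<epsilon> d x u \<longleftrightarrow>
     locally_abs_continuous_on {0..} x \<and>
     continuous_on {- r - \<epsilon>..} u \<and>
     (AE t in lebesgue_on {0..}.
        (x has_vector_derivative (A *v x t + B *v u (t - r - \<epsilon> * d t))) (at t)) \<and>
     (\<forall>t\<ge>0. u t = (k ** matexp (r *\<^sub>R A)) *v x t +
        k *v integral {t..t + r} (\<lambda>s. matexp ((t + r - s) *\<^sub>R A) *v (B *v u (s - r))))"

(* The suprema are maxima, as u and u0 are continuous on the compact intervals involved. *)
definition exponential_estimate ::
  "real ^ 'n ^ 'n \<Rightarrow> real ^ 'm ^ 'n \<Rightarrow> real ^ 'n ^ 'm \<Rightarrow> real \<Rightarrow> real \<Rightarrow> real \<Rightarrow> real \<Rightarrow> bool" where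
  "exponential_estimate A B k r \<epsilon> Q \<sigma> \<longleftrightarrow>
     (\<forall>d \<in> Linfty {0..} {-1..1}. \<forall>(x0 :: real ^ 'n) (u0 :: real \<Rightarrow> real ^ 'm).
        continuous_on {- r - \<epsilon>..0} u0 \<and>
        u0 0 = (k ** matexp (r *\<^sub>R A)) *v x0 +
          k *v integral {- r..0} (\<lambda>s. matexp ((- s) *\<^sub>R A) *v (B *v u0 s)) \<longrightarrow>
        (\<forall>x u. closed_loop_solution A B k r \<epsilon> d x u \<and> x 0 = x0 \<and>
               (\<forall>t\<in>{- r - \<epsilon>..0}. u t = u0 t) \<longrightarrow>
          (\<forall>t\<ge>0. norm (x t) + (SUP s\<in>{t - \<epsilon> - r..t}. norm (u s))
                  \<le> Q * exp (- \<sigma> * t) *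
                     (norm x0 + (SUP s\<in>{- \<epsilon> - r..0}. norm (u0 s))))))"

end

theory Submission
  imports Defs
begin

text \<open>
  Let $z(t) = e^{Ar} x(t) + \int_{t-r}^{t} e^{A(t-s)} B u(s)\,ds$ be the predictor state, so that $u = k z$ on
  $[0, \infty)$. With $M = A + Bk$ it satisfies $z' = M z + v$ almost everywhere, where
  $v(t) = e^{Ar} B (u(t - r - \varepsilon d(t)) - u(t - r))$. For $t \ge r + \varepsilon$ the perturbation $v(t)$ is
  $e^{Ar} B k$ applied to an increment of $z$ over an interval of length at most $\varepsilon$. If $\kappa$ bounds
  $|e^{M\tau} - I|$ for $0 \le \tau \le \varepsilon$, then by variation of constants such an increment is at most
  $\kappa |z|$ plus $\Theta (1 - e^{-\lambda\varepsilon}) / \lambda$ times the supremum of $|v|$, while $|z|$ is at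
  most a decaying term plus $\Theta/\lambda$ times that supremum. So the loop is contractive if
  $\Theta |e^{Ar} B k| (\kappa + 1 - e^{-\lambda\varepsilon}) < \lambda$; a small exponential weight preserves
  the strict inequality and yields the decay rate. In general $\kappa = e^{|M|\varepsilon} - 1$; for $n = 1$ one has
  $\Theta = 1$, $\lambda = |M|$ and $\kappa = 1 - e^{-|M|\varepsilon}$.

  The matrix exponential is handled as \<^const>\<open>exp\<close> in the Banach algebra of bounded endomorphisms.
\<close>

section \<open>The Banach algebra of bounded endomorphisms\<close>

text \<open>A type of its own, so that \<open>*\<close> can mean composition and \<open>exp\<close>
  with its whole calculus refers to the operator exponential.\<close>

typedef (overloaded) 'a endo = "UNIV :: ('a::real_normed_vector \<Rightarrow>\<^sub>L 'a) set"
  morphisms blinfun_of_endo Endo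
  by simp

setup_lifting type_definition_endo

instantiation endo :: (real_normed_vector) real_normed_vector
begin

lift_definition norm_endo :: "'a endo \<Rightarrow> real" is norm .
lift_definition zero_endo :: "'a endo" is 0 .
lift_definition plus_endo :: "'a endo \<Rightarrow> 'a endo \<Rightarrow> 'a endo" is "(+)" .
lift_definition minus_endo :: "'a endo \<Rightarrow> 'a endo \<Rightarrow> 'a endo" is "(-)" .
lift_definition uminus_endo :: "'a endo \<Rightarrow> 'a endo" is uminus .
lift_definition scaleR_endo :: "real \<Rightarrow> 'a endo \<Rightarrow> 'a endo" is "(*\<^sub>R)" .

definition dist_endo :: "'a endo \<Rightarrow> 'a endo \<Rightarrow> real"
  where "dist_endo f g = norm (f - g)"

definition uniformity_endo :: "('a endo \<times> 'a endo) filter"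
  where [code del]: "uniformity_endo = (INF e\<in>{0 <..}. principal {(x, y). dist x y < e})"

definition open_endo :: "'a endo set \<Rightarrow> bool"
  where [code del]: "open_endo S = (\<forall>x\<in>S. \<forall>\<^sub>F (x', y) in uniformity. x' = x \<longrightarrow> y \<in> S)"

definition sgn_endo :: "'a endo \<Rightarrow> 'a endo"
  where "sgn_endo f = inverse (norm f) *\<^sub>R f"

instance
  apply standard
  unfolding dist_endo_def uniformity_endo_def open_endo_def sgn_endo_def
  apply (rule refl | (transfer, simp add: algebra_simps norm_triangle_ineq))+
  done

end

lemma dist_endo_eq: "dist f g = dist (blinfun_of_endo f) (blinfun_of_endo g)"
  unfolding dist_norm by transfer simp

instance endo :: (banach) banach
proof
  fix X :: "nat \<Rightarrow> 'a endo"
  assume "Cauchy X"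
  then have "Cauchy (\<lambda>n. blinfun_of_endo (X n))"
    by (simp add: Cauchy_def dist_endo_eq)
  then obtain L where "(\<lambda>n. blinfun_of_endo (X n)) \<longlonglongrightarrow> L"
    using Cauchy_convergent convergent_def by blast
  then have "X \<longlonglongrightarrow> Endo L"
    by (simp add: lim_sequentially dist_endo_eq Endo_inverse)
  then show "convergent X"
    by (rule convergentI)
qed

lift_definition endo_apply :: "'a::real_normed_vector endo \<Rightarrow> 'a \<Rightarrow> 'a" is blinfun_apply .

lemma endo_eqI: "(\<And>x. endo_apply f x = endo_apply g x) \<Longrightarrow> f = g"
  by transfer (auto intro: blinfun_eqI)

lemma norm_endo_apply_le: "norm (endo_apply f x) \<le> norm f * norm x"
  by transfer (rule norm_blinfun)

lemma norm_endo_eq_onorm: "norm f = onorm (endo_apply f)"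
  by transfer (rule norm_blinfun.rep_eq)

lemma endo_apply_Endo [simp]: "endo_apply (Endo f) = blinfun_apply f"
  by (simp add: endo_apply_def Endo_inverse)

lemma bounded_bilinear_endo_apply: "bounded_bilinear endo_apply"
proof
  show "\<exists>K. \<forall>f x. norm (endo_apply f x) \<le> norm f * norm x * K"
    using norm_endo_apply_le by (metis mult.right_neutral)
qed (transfer, simp add: blinfun.bilinear_simps)+

interpretation endo_apply: bounded_bilinear endo_apply
  by (rule bounded_bilinear_endo_apply)

text \<open>The sort \<open>perfect_space\<close> excludes the zero space, on which the identity
  would have norm 0 and coincide with 0.\<close>

instantiation endo :: ("{real_normed_vector, perfect_space}") real_normed_algebra_1
begin

lift_definition times_endo :: "'a endo \<Rightarrow> 'a endo \<Rightarrow> 'a endo" is "(o\<^sub>L)" .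
lift_definition one_endo :: "'a endo" is id_blinfun .

instance
proof
  show "norm (1 :: 'a endo) = 1"
    by transfer simp
  then show "(0 :: 'a endo) \<noteq> 1"
    by (metis norm_zero zero_neq_one)
qed (transfer, auto intro!: blinfun_eqI norm_blinfun_compose simp: blinfun.bilinear_simps)+

end

lemma endo_apply_times [simp]: "endo_apply (f * g) x = endo_apply f (endo_apply g x)"
  by transfer simp

lemma endo_apply_one [simp]: "endo_apply 1 x = x"
  by transfer simp

section \<open>Calculus of the exponential in a Banach algebra\<close>

lemma continuous_on_exp_scaleR [continuous_intros]:
  fixes a :: "'a::{real_normed_algebra_1, banach}"
  assumes "continuous_on S f"
  shows "continuous_on S (\<lambda>t. exp (f t *\<^sub>R a))"
proof (rule continuous_on_compose2[of UNIV "\<lambda>t. exp (t *\<^sub>R a)" S f])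
  show "continuous_on UNIV (\<lambda>t. exp (t *\<^sub>R a))"
    by (rule continuous_on_vector_derivative[OF exp_scaleR_has_vector_derivative_right])
qed (use assms in auto)

lemma exp_scaleR_add:
  fixes a :: "'a::{real_normed_algebra_1, banach}"
  shows "exp ((s + t) *\<^sub>R a) = exp (s *\<^sub>R a) * exp (t *\<^sub>R a)"
  by (simp add: scaleR_add_left exp_add_commuting)

text \<open>This is the kernel of the variation-of-constants formula, differentiated in its
  integration variable; the inner derivative -1 produces the sign that later cancels the
  drift.\<close>

lemma has_vector_derivative_exp_reflected:
  fixes f :: "'a::{real_normed_algebra_1, banach}"
  shows "((\<lambda>s. exp ((c - s) *\<^sub>R f)) has_vector_derivative - (exp ((c - s) *\<^sub>R f) * f)) (at s within S)"
proof -
  have "((\<lambda>s. c - s) has_real_derivative -1) (at s within S)"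
    by (auto intro!: derivative_eq_intros)
  then have "((\<lambda>s. c - s) has_vector_derivative -1) (at s within S)"
    by (simp add: has_real_derivative_iff_has_vector_derivative)
  from vector_diff_chain_within[OF this exp_scaleR_has_vector_derivative_right[of f]]
  show ?thesis
    by (simp add: o_def)
qed

text \<open>The exponential series without its constant term, estimated term by term. It supplies
  the value of \<kappa> in general dimension.\<close>

lemma norm_exp_minus_one_le:
  fixes f :: "'a::{real_normed_algebra_1, banach}"
  shows "norm (exp f - 1) \<le> exp (norm f) - 1"
proof -
  have s: "(\<lambda>n. f ^ Suc n /\<^sub>R fact (Suc n)) sums (exp f - 1)"
    using sums_split_initial_segment[OF exp_converges[of f], of 1] by simp
  have t: "(\<lambda>n. norm f ^ Suc n /\<^sub>R fact (Suc n)) sums (exp (norm f) - 1)"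
    using sums_split_initial_segment[OF exp_converges[of "norm f"], of 1] by simp
  have "norm (f ^ Suc n /\<^sub>R fact (Suc n)) \<le> norm f ^ Suc n /\<^sub>R fact (Suc n)" for n
    using norm_power_ineq[of f "Suc n"] by (simp add: divide_simps del: fact_Suc power_Suc)
  from norm_suminf_le[OF this sums_summable[OF t]] show ?thesis
    using s t by (metis sums_unique)
qed

section \<open>Matrices as bounded endomorphisms\<close>

definition endo_of_matrix :: "real ^ 'n ^ 'n \<Rightarrow> (real ^ 'n) endo" where
  "endo_of_matrix M = Endo (Blinfun ((*v) M))"

lemma endo_apply_endo_of_matrix [simp]: "endo_apply (endo_of_matrix M) = (*v) M"
  by (simp add: endo_of_matrix_def bounded_linear_Blinfun_apply matrix_vector_mul_bounded_linear)

lemma norm_endo_of_matrix: "norm (endo_of_matrix M) = opnorm M"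
  by (simp add: norm_endo_eq_onorm opnorm_def)

lemma endo_of_matrix_mult: "endo_of_matrix (M ** N) = endo_of_matrix M * endo_of_matrix N"
  by (rule endo_eqI) (simp add: matrix_vector_mul_assoc)

lemma endo_of_matrix_add: "endo_of_matrix (M + N) = endo_of_matrix M + endo_of_matrix N"
  by (rule endo_eqI) (simp add: matrix_vector_mult_add_rdistrib endo_apply.add_left)

lemma endo_of_matrix_scaleR: "endo_of_matrix (c *\<^sub>R M) = c *\<^sub>R endo_of_matrix M"
  by (rule endo_eqI) (simp add: scaleR_matrix_vector_assoc endo_apply.scaleR_left)

lemma endo_of_matrix_mat: "endo_of_matrix (mat c) = of_real c"
  by (rule endo_eqI) (simp add: of_real_def endo_apply.scaleR_left mat_def matrix_vector_mult_def vec_eq_iff if_distrib if_distribR cong: if_cong)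

lemma exp_scaleR_endo_of_matrix_mat:
  "exp (t *\<^sub>R endo_of_matrix (mat c :: real ^ 'n ^ 'n)) = of_real (exp (c * t))"
proof -
  have "t *\<^sub>R endo_of_matrix (mat c :: real ^ 'n ^ 'n) = of_real (c * t)"
    by (simp add: endo_of_matrix_mat of_real_def mult.commute)
  then show ?thesis
    by (simp only: exp_of_real)
qed

lemma endo_of_matrix_matpow: "endo_of_matrix (matpow M j) = endo_of_matrix M ^ j"
  by (induction j) (simp_all add: endo_of_matrix_mult endo_of_matrix_mat)

lemma endo_of_matrix_inj: "endo_of_matrix M = endo_of_matrix N \<longleftrightarrow> M = N"
  by (metis endo_apply_endo_of_matrix matrix_eq)

text \<open>Needed to push the limit of a series from operators to matrices. Each entry is the
  evaluation of \<open>f\<close> at a basis vector followed by a coordinate, hence bounded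
  linear.\<close>

lemma bounded_linear_matrix_endo_apply:
  "bounded_linear (\<lambda>f :: (real ^ 'n) endo. matrix (endo_apply f))"
proof -
  have "bounded_linear (\<lambda>f :: (real ^ 'n) endo. endo_apply f (axis j 1) $ i)" for i j
    by (intro bounded_linear_compose[OF bounded_linear_vec_nth] endo_apply.bounded_linear_left)
  then show ?thesis
    by (subst bounded_linear_componentwise_iff)
      (auto simp: Basis_vec_def matrix_def inner_axis)
qed

text \<open>The series defining \<open>matexp\<close> is the image of the exponential series of
  operators under a bounded linear map, so it converges to the image of the sum.\<close>

lemma matexp_conv_exp: "matexp M = matrix (endo_apply (exp (endo_of_matrix M)))"
proof -
  have "matrix (endo_apply (endo_of_matrix M ^ j /\<^sub>R fact j)) = (1 / fact j) *\<^sub>R matpow M j" for j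
    by (simp flip: endo_of_matrix_matpow endo_of_matrix_scaleR add: inverse_eq_divide)
  with bounded_linear.sums[OF bounded_linear_matrix_endo_apply exp_converges[of "endo_of_matrix M"]]
  show ?thesis
    unfolding matexp_def by (simp add: sums_iff)
qed

lemma endo_of_matrix_matexp: "endo_of_matrix (matexp M) = exp (endo_of_matrix M)"
proof (rule endo_eqI)
  fix x
  have "linear (endo_apply (exp (endo_of_matrix M)))"
    by (intro bounded_linear.linear endo_apply.bounded_linear_right)
  then show "endo_apply (endo_of_matrix (matexp M)) x = endo_apply (exp (endo_of_matrix M)) x"
    by (simp add: matexp_conv_exp matrix_works)
qed

lemma matexp_mult_vector: "matexp (t *\<^sub>R M) *v x = endo_apply (exp (t *\<^sub>R endo_of_matrix M)) x"
  by (metis endo_apply_endo_of_matrix endo_of_matrix_matexp endo_of_matrix_scaleR)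

section \<open>Absolutely continuous functions\<close>

lemma abs_continuous_onD:
  assumes "abs_continuous_on S f" "e > 0"
  obtains \<delta> where "\<delta> > 0"
    "\<And>D. \<lbrakk>finite D; \<And>a b. (a, b) \<in> D \<Longrightarrow> a < b \<and> {a..b} \<subseteq> S;
       disjoint_family_on (\<lambda>(a, b). {a<..<b}) D; (\<Sum>(a, b)\<in>D. b - a) < \<delta>\<rbrakk>
       \<Longrightarrow> (\<Sum>(a, b)\<in>D. norm (f b - f a)) < e"
proof -
  obtain \<delta> where "\<delta> > 0" and \<delta>: "\<forall>D :: (real \<times> real) set.
        finite D \<and> (\<forall>(a, b)\<in>D. a < b \<and> {a..b} \<subseteq> S) \<and>
        disjoint_family_on (\<lambda>(a, b). {a<..<b}) D \<and>
        (\<Sum>(a, b)\<in>D. b - a) < \<delta>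
        \<longrightarrow> (\<Sum>(a, b)\<in>D. norm (f b - f a)) < e"
    using assms unfolding abs_continuous_on_def by meson
  show ?thesis
    by (rule that[OF \<open>\<delta> > 0\<close>], rule \<delta>[rule_format]) auto
qed

lemma abs_continuous_on_subset: "abs_continuous_on T f \<Longrightarrow> S \<subseteq> T \<Longrightarrow> abs_continuous_on S f"
  unfolding abs_continuous_on_def
  by (elim all_forward imp_forward ex_forward conj_forward) (fastforce simp: subset_iff)+

text \<open>A single comparison principle behind sums, products, Lipschitz functions, and the
  passage to another function with the same increments on \<open>S\<close>.\<close>

lemma abs_continuous_on_dominated:
  assumes f: "abs_continuous_on S f" and g: "abs_continuous_on S g"
    and C: "\<And>a b. \<lbrakk>a < b; {a..b} \<subseteq> S\<rbrakk> \<Longrightarrow> norm (h b - h a) \<le> C * (norm (f b - f a) + norm (g b - g a))"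
  shows "abs_continuous_on S h"
  unfolding abs_continuous_on_def
proof (intro allI impI)
  fix e :: real assume "e > 0"
  \<comment> \<open>Adding 1 to the absolute value gives a positive factor whatever the sign of
    \<open>C\<close>; the 2 shares the tolerance between \<open>f\<close> and
    \<open>g\<close>.\<close>
  define e' where "e' = e / (2 * (\<bar>C\<bar> + 1))"
  have "e' > 0"
    using \<open>e > 0\<close> by (simp add: e'_def add_nonneg_pos)
  obtain \<delta>f where f: "\<delta>f > 0"
    "\<And>D. \<lbrakk>finite D; \<And>a b. (a, b) \<in> D \<Longrightarrow> a < b \<and> {a..b} \<subseteq> S;
       disjoint_family_on (\<lambda>(a, b). {a<..<b}) D; (\<Sum>(a, b)\<in>D. b - a) < \<delta>f\<rbrakk>
       \<Longrightarrow> (\<Sum>(a, b)\<in>D. norm (f b - f a)) < e'"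
    by (rule abs_continuous_onD[OF f \<open>e' > 0\<close>]) blast
  obtain \<delta>g where g: "\<delta>g > 0"
    "\<And>D. \<lbrakk>finite D; \<And>a b. (a, b) \<in> D \<Longrightarrow> a < b \<and> {a..b} \<subseteq> S;
       disjoint_family_on (\<lambda>(a, b). {a<..<b}) D; (\<Sum>(a, b)\<in>D. b - a) < \<delta>g\<rbrakk>
       \<Longrightarrow> (\<Sum>(a, b)\<in>D. norm (g b - g a)) < e'"
    by (rule abs_continuous_onD[OF g \<open>e' > 0\<close>]) blast
  show "\<exists>\<delta>>0. \<forall>D. finite D \<and> (\<forall>(a, b)\<in>D. a < b \<and> {a..b} \<subseteq> S) \<and>
        disjoint_family_on (\<lambda>(a, b). {a<..<b}) D \<and> (\<Sum>(a, b)\<in>D. b - a) < \<delta>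
        \<longrightarrow> (\<Sum>(a, b)\<in>D. norm (h b - h a)) < e"
  proof (intro exI[of _ "min \<delta>f \<delta>g"] conjI allI impI)
    fix D :: "(real \<times> real) set"
    assume D: "finite D \<and> (\<forall>(a, b)\<in>D. a < b \<and> {a..b} \<subseteq> S) \<and>
        disjoint_family_on (\<lambda>(a, b). {a<..<b}) D \<and> (\<Sum>(a, b)\<in>D. b - a) < min \<delta>f \<delta>g"
    have "(\<Sum>(a, b)\<in>D. norm (h b - h a)) \<le>
        (\<Sum>(a, b)\<in>D. (\<bar>C\<bar> + 1) * (norm (f b - f a) + norm (g b - g a)))"
    proof (rule sum_mono, clarify)
      fix a b assume "(a, b) \<in> D"
      with D have "norm (h b - h a) \<le> C * (norm (f b - f a) + norm (g b - g a))"
        by (intro C) auto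
      also have "\<dots> \<le> (\<bar>C\<bar> + 1) * (norm (f b - f a) + norm (g b - g a))"
        by (intro mult_right_mono) auto
      finally show "norm (h b - h a) \<le> (\<bar>C\<bar> + 1) * (norm (f b - f a) + norm (g b - g a))" .
    qed
    also have "\<dots> = (\<bar>C\<bar> + 1) * ((\<Sum>(a, b)\<in>D. norm (f b - f a)) + (\<Sum>(a, b)\<in>D. norm (g b - g a)))"
      by (simp add: sum_distrib_left sum.distrib[symmetric] split_def)
    also have "\<dots> < (\<bar>C\<bar> + 1) * (e' + e')"
      using D by (intro mult_strict_left_mono add_strict_mono f g) auto
    also have "\<dots> = e"
      using add_nonneg_pos[OF abs_ge_zero zero_less_one, of C] by (simp add: e'_def divide_simps)
    finally show "(\<Sum>(a, b)\<in>D. norm (h b - h a)) < e" .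
  qed (use f g in auto)
qed

lemma abs_continuous_on_ident: "abs_continuous_on S (\<lambda>t :: real. t)"
  unfolding abs_continuous_on_def
proof (intro allI impI)
  fix e :: real assume "e > 0"
  have "(\<Sum>(a, b)\<in>D. norm (b - a)) = (\<Sum>(a, b)\<in>D. b - a)"
    if "\<forall>(a, b)\<in>D. a < b \<and> {a..b} \<subseteq> S" for D :: "(real \<times> real) set"
    using that by (intro sum.cong) auto
  with \<open>e > 0\<close> show "\<exists>\<delta>>0. \<forall>D. finite D \<and> (\<forall>(a, b)\<in>D. a < b \<and> {a..b} \<subseteq> S) \<and>
        disjoint_family_on (\<lambda>(a, b). {a<..<b}) D \<and> (\<Sum>(a, b)\<in>D. b - a) < \<delta>
        \<longrightarrow> (\<Sum>(a, b)\<in>D. norm (b - a)) < e"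
    by (intro exI[of _ e]) auto
qed

lemma abs_continuous_on_add:
  assumes "abs_continuous_on S f" "abs_continuous_on S g"
  shows "abs_continuous_on S (\<lambda>t. f t + g t)"
proof (rule abs_continuous_on_dominated[OF assms])
  fix a b
  show "norm (f b + g b - (f a + g a)) \<le> 1 * (norm (f b - f a) + norm (g b - g a))"
    by (simp add: add_diff_add norm_triangle_ineq)
qed

text \<open>A family consisting of one interval already tests ordinary continuity.\<close>

lemma abs_continuous_on_imp_continuous_on:
  assumes "abs_continuous_on {a..b} f"
  shows "continuous_on {a..b} f"
  unfolding continuous_on_iff
proof (intro ballI allI impI)
  fix t e :: real assume t: "t \<in> {a..b}" and "e > 0"
  obtain \<delta> where \<delta>: "\<delta> > 0"
    "\<And>D. \<lbrakk>finite D; \<And>c d. (c, d) \<in> D \<Longrightarrow> c < d \<and> {c..d} \<subseteq> {a..b};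
       disjoint_family_on (\<lambda>(c, d). {c<..<d}) D; (\<Sum>(c, d)\<in>D. d - c) < \<delta>\<rbrakk>
       \<Longrightarrow> (\<Sum>(c, d)\<in>D. norm (f d - f c)) < e"
    by (rule abs_continuous_onD[OF assms \<open>e > 0\<close>]) blast
  have *: "norm (f d - f c) < e" if "c < d" "c \<in> {a..b}" "d \<in> {a..b}" "d - c < \<delta>" for c d
    using \<delta>(2)[of "{(c, d)}"] that by (auto simp: disjoint_family_on_def)
  show "\<exists>\<delta>>0. \<forall>s\<in>{a..b}. dist s t < \<delta> \<longrightarrow> dist (f s) (f t) < e"
  proof (intro exI[of _ \<delta>] conjI ballI impI \<delta>(1))
    fix s assume "s \<in> {a..b}" "dist s t < \<delta>"
    then show "dist (f s) (f t) < e"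
      using *[of s t] *[of t s] t \<open>e > 0\<close>
      by (cases s t rule: linorder_cases) (auto simp: dist_norm norm_minus_commute)
  qed
qed

text \<open>The derivative is bounded on the compact interval, so \<open>f\<close> is Lipschitz,
  that is, dominated by the identity. The identity fills both slots of the comparison principle,
  whence \<open>C / 2\<close>.\<close>

lemma abs_continuous_on_has_vector_derivative:
  assumes f: "\<And>t. t \<in> {a..b} \<Longrightarrow> (f has_vector_derivative f' t) (at t within {a..b})"
    and f': "continuous_on {a..b} f'"
  shows "abs_continuous_on {a..b} f"
proof -
  have "bounded (f' ` {a..b})"
    by (intro compact_imp_bounded compact_continuous_image f' compact_Icc)
  then obtain C where C: "\<And>t. t \<in> {a..b} \<Longrightarrow> norm (f' t) \<le> C"
    unfolding bounded_iff by blast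
  show ?thesis
  proof (rule abs_continuous_on_dominated[OF abs_continuous_on_ident abs_continuous_on_ident])
    fix c d :: real assume "c < d" "{c..d} \<subseteq> {a..b}"
    then have "norm (f d - f c) \<le> C * norm (d - c)"
      using f C by (intro differentiable_bound[of "{a..b}" f "\<lambda>t h. h *\<^sub>R f' t"])
        (auto simp: has_vector_derivative_def onorm_scaleR_left[OF bounded_linear_ident] onorm_id)
    then show "norm (f d - f c) \<le> C / 2 * (norm (d - c) + norm (d - c))"
      by simp
  qed
qed

text \<open>The increment of a product splits into one increment for each factor, and the other
  factor is bounded by compactness.\<close>

lemma (in bounded_bilinear) abs_continuous_on:
  assumes f: "abs_continuous_on {a..b} f" and g: "abs_continuous_on {a..b} g"
  shows "abs_continuous_on {a..b} (\<lambda>t. prod (f t) (g t))"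
proof -
  obtain K where K: "K > 0" "\<And>x y. norm (prod x y) \<le> norm x * norm y * K"
    using pos_bounded by blast
  have "bounded (f ` {a..b})" "bounded (g ` {a..b})"
    by (intro compact_imp_bounded compact_continuous_image compact_Icc abs_continuous_on_imp_continuous_on f g)+
  then obtain Cf Cg where C: "\<And>t. t \<in> {a..b} \<Longrightarrow> norm (f t) \<le> Cf" "\<And>t. t \<in> {a..b} \<Longrightarrow> norm (g t) \<le> Cg"
    unfolding bounded_iff by (metis imageI)
  show ?thesis
  proof (rule abs_continuous_on_dominated[OF f g])
    fix c d :: real assume "c < d" "{c..d} \<subseteq> {a..b}"
    then have cd: "c \<in> {a..b}" "d \<in> {a..b}"
      by auto
    have "Cf \<ge> 0" "Cg \<ge> 0"
      using C[OF cd(1)] norm_ge_zero order.trans by blast+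
    have "prod (f d) (g d) - prod (f c) (g c) = prod (f d - f c) (g d) + prod (f c) (g d - g c)"
      by (simp add: diff_left diff_right)
    also have "norm \<dots> \<le> norm (f d - f c) * norm (g d) * K + norm (f c) * norm (g d - g c) * K"
      by (intro order.trans[OF norm_triangle_ineq] add_mono K)
    also have "\<dots> \<le> norm (f d - f c) * (Cf + Cg) * K + (Cf + Cg) * norm (g d - g c) * K"
      using C(2)[OF cd(2)] C(1)[OF cd(1)] \<open>Cf \<ge> 0\<close> \<open>Cg \<ge> 0\<close> K(1)
      by (intro add_mono mult_right_mono mult_left_mono) auto
    finally show "norm (prod (f d) (g d) - prod (f c) (g c)) \<le>
        (Cf + Cg) * K * (norm (f d - f c) + norm (g d - g c))"
      by (simp add: algebra_simps)
  qed
qed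

text \<open>The gauge is the usual straddle gauge off the exceptional set $N$ and a thin open neighbourhood of
  $N$ on it; absolute continuity controls the intervals tagged in $N$.\<close>

theorem fundamental_theorem_of_calculus_abs_continuous:
  fixes f :: "real \<Rightarrow> 'a::real_normed_vector"
  assumes "a \<le> b" and f: "abs_continuous_on {a..b} f" and N: "negligible N"
    and f': "\<And>t. t \<in> {a..b} - N \<Longrightarrow> (f has_vector_derivative f' t) (at t within {a..b})"
  shows "(f' has_integral (f b - f a)) {a..b}"
proof -
  \<comment> \<open>With value 0 on \<open>N\<close>, an interval tagged there contributes only the
    increment of \<open>f\<close>. Changing \<open>f'\<close> on the null set \<open>N\<close> is
    undone by a spike argument at the end.\<close>
  define g where "g t = (if t \<in> N then 0 else f' t)" for t
  have "(g has_integral (f b - f a)) {a..b}"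
    unfolding has_integral_real
  proof (intro allI impI)
    fix e :: real assume "e > 0"
    \<comment> \<open>The straddle errors add up to at most \<open>e1 * (b - a)\<close>; the
      \<open>+ 1\<close> keeps the denominator positive when \<open>a = b\<close>.\<close>
    define e1 where "e1 = e / (2 * (b - a + 1))"
    have "e1 > 0"
      using \<open>e > 0\<close> \<open>a \<le> b\<close> by (simp add: e1_def)
    have "e1 * (b - a) \<le> e1 * (b - a + 1)"
      using \<open>e1 > 0\<close> by (intro mult_left_mono) auto
    also have "\<dots> = e / 2"
      using \<open>a \<le> b\<close> by (simp add: e1_def field_simps)
    finally have e1: "e1 * (b - a) \<le> e / 2" .
    have "e / 2 > 0"
      using \<open>e > 0\<close> by simp
    then obtain \<delta> where \<delta>: "\<delta> > 0"
      "\<And>D. \<lbrakk>finite D; \<And>c d. (c, d) \<in> D \<Longrightarrow> c < d \<and> {c..d} \<subseteq> {a..b};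
         disjoint_family_on (\<lambda>(c, d). {c<..<d}) D; (\<Sum>(c, d)\<in>D. d - c) < \<delta>\<rbrakk>
         \<Longrightarrow> (\<Sum>(c, d)\<in>D. norm (f d - f c)) < e / 2"
      by (rule abs_continuous_onD[OF f]) blast
    have "N \<in> null_sets lebesgue"
      using N by (simp add: negligible_iff_null_sets)
    \<comment> \<open>Outer regularity: since \<open>N\<close> is null, the measure of
      \<open>T\<close> is that of \<open>T - N\<close>, hence below \<delta>.\<close>
    then obtain T where T: "open T" "N \<subseteq> T" "T - N \<in> lmeasurable" "emeasure lebesgue (T - N) < ennreal \<delta>"
      using sets_lebesgue_outer_open[of N \<delta>] \<delta>(1) by blast
    have "emeasure lebesgue T = emeasure lebesgue (T - N)"
      by (simp add: emeasure_Diff_null_set \<open>N \<in> null_sets lebesgue\<close> T(1))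
    with T have T_meas: "T \<in> lmeasurable"  "measure lebesgue T < \<delta>"
      using \<delta>(1) by (auto simp: fmeasurable_def measure_def ennreal_less_top intro: less_trans)
    have "\<exists>\<rho>>0. \<forall>s\<in>{a..b}. \<bar>s - t\<bar> < \<rho> \<longrightarrow> norm (f s - f t - (s - t) *\<^sub>R f' t) \<le> e1 * \<bar>s - t\<bar>"
      if "t \<in> {a..b} - N" for t
      using f'[OF that] \<open>e1 > 0\<close>
      unfolding has_vector_derivative_def has_derivative_within_alt by (auto simp: real_norm_def)
    then obtain \<rho> where \<rho>: "\<And>t. t \<in> {a..b} - N \<Longrightarrow> \<rho> t > 0"
      "\<And>s t. \<lbrakk>t \<in> {a..b} - N; s \<in> {a..b}; \<bar>s - t\<bar> < \<rho> t\<rbrakk> \<Longrightarrow> norm (f s - f t - (s - t) *\<^sub>R f' t) \<le> e1 * \<bar>s - t\<bar>"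
      by metis
    define \<gamma> where "\<gamma> t = (if t \<in> N then T else if t \<in> {a..b} then ball t (\<rho> t) else UNIV)" for t
    have "gauge \<gamma>"
      using T \<rho>(1) by (auto simp: gauge_def \<gamma>_def)
    moreover have "norm ((\<Sum>(t, K)\<in>p. measure lborel K *\<^sub>R g t) - (f b - f a)) < e"
      if p: "p tagged_division_of {a..b}" and fine: "\<gamma> fine p" for p
    proof -
      note pD = tagged_division_ofD[OF p]
      have K_Icc: "K = {Inf K..Sup K}"
        and K: "Inf K \<le> t \<and> t \<le> Sup K \<and> a \<le> Inf K \<and> Sup K \<le> b \<and> {Inf K..Sup K} \<subseteq> \<gamma> t"
        if "(t, K) \<in> p" for t K
      proof -
        obtain c d where "K = {c..d}"
          using pD(4)[OF \<open>(t, K) \<in> p\<close>] by (auto simp: cbox_interval)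
        with pD(2,3)[OF \<open>(t, K) \<in> p\<close>] fine that
        show "K = {Inf K..Sup K}"
          and "Inf K \<le> t \<and> t \<le> Sup K \<and> a \<le> Inf K \<and> Sup K \<le> b \<and> {Inf K..Sup K} \<subseteq> \<gamma> t"
          by (auto simp: fine_def)
      qed
      \<comment> \<open>The intervals tagged in \<open>N\<close>. Degenerate ones are dropped:
        absolute continuity speaks of \<open>a < b\<close>, and they carry neither length nor
        increment. Nonempty interiors also make the map to endpoints injective.\<close>
      define q where "q = {(t, K) \<in> p. t \<in> N \<and> Inf K < Sup K}"
      define D where "D = (\<lambda>(t, K). (Inf K, Sup K)) ` q"
      have fin: "finite p" "finite q"
        using pD(1) by (auto simp: q_def intro: finite_subset[of _ p])
      have inter: "{Inf K<..<Sup K} \<inter> {Inf L<..<Sup L} = {}"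
        if "(t, K) \<in> p" "(s, L) \<in> p" "(t, K) \<noteq> (s, L)" for t s K L
        using pD(5)[OF that] K_Icc[OF that(1)] K_Icc[OF that(2)] interior_atLeastAtMost_real by metis
      have inj: "inj_on (\<lambda>(t, K). (Inf K, Sup K)) q"
      proof (rule inj_onI, clarify)
        fix t s and K L :: "real set"
        assume q: "(t, K) \<in> q" "(s, L) \<in> q" "Inf K = Inf L" "Sup K = Sup L"
        then have "{Inf K<..<Sup K} \<noteq> {}" "(t, K) \<in> p" "(s, L) \<in> p"
          by (auto simp: q_def)
        then show "t = s \<and> K = L"
          using inter[of t K s L] q by auto
      qed
      have D_disj: "disjoint_family_on (\<lambda>(c, d). {c<..<d}) D"
        unfolding disjoint_family_on_def D_def q_def using inter by force
      have D_sub: "c < d \<and> {c..d} \<subseteq> {a..b} \<and> {c..d} \<subseteq> T" if "(c, d) \<in> D" for c d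
        using that K unfolding D_def q_def \<gamma>_def by fastforce
      have "finite D"
        by (simp add: D_def fin)
      \<comment> \<open>These intervals have disjoint interiors and lie in \<open>T\<close>, so
        their total length stays below \<delta> and absolute continuity applies.\<close>
      have "(\<Sum>(c, d)\<in>D. d - c) = (\<Sum>(c, d)\<in>D. measure lebesgue {c<..<d})"
        using D_sub by (intro sum.cong) (auto simp: less_imp_le)
      also have "\<dots> = (\<Sum>i\<in>D. measure lebesgue ((\<lambda>(c, d). {c<..<d}) i))"
        by (simp add: split_def)
      also have "\<dots> = measure lebesgue (\<Union>i\<in>D. (\<lambda>(c, d). {c<..<d}) i)"
      proof (rule measure_finite_Union[symmetric, OF \<open>finite D\<close> _ D_disj])
        show "emeasure lebesgue ((\<lambda>(c, d). {c<..<d}) i) \<noteq> \<infinity>" if "i \<in> D" for i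
          using that D_sub by (cases i) (auto simp: less_imp_le)
      qed auto
      also have "\<dots> \<le> measure lebesgue T"
      proof (rule measure_mono_fmeasurable[OF _ _ T_meas(1)])
        show "(\<Union>i\<in>D. (\<lambda>(c, d). {c<..<d}) i) \<subseteq> T"
          using D_sub by force
        show "(\<Union>i\<in>D. (\<lambda>(c, d). {c<..<d}) i) \<in> sets lebesgue"
          using \<open>finite D\<close> by (intro sets.finite_UN) auto
      qed
      also note T_meas(2)
      finally have "(\<Sum>(c, d)\<in>D. norm (f d - f c)) < e / 2"
        by (intro \<delta>(2) \<open>finite D\<close> D_disj) (use D_sub in auto)
      also have "(\<Sum>(c, d)\<in>D. norm (f d - f c)) = (\<Sum>(t, K)\<in>q. norm (f (Sup K) - f (Inf K)))"
        unfolding D_def by (subst sum.reindex[OF inj]) (simp add: split_def)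
      finally have q_sum: "(\<Sum>(t, K)\<in>q. norm (f (Sup K) - f (Inf K))) < e / 2" .
      \<comment> \<open>A tag off \<open>N\<close> costs a straddle error proportional to the
        length; a tag in \<open>N\<close> costs the full increment, which is already controlled in
        total.\<close>
      have term_le: "norm (measure lborel K *\<^sub>R g t - (f (Sup K) - f (Inf K))) \<le>
          e1 * measure lborel K + (if (t, K) \<in> q then norm (f (Sup K) - f (Inf K)) else 0)"
        if tK: "(t, K) \<in> p" for t K
      proof (cases "t \<in> N")
        case True
        have "0 \<le> e1 * measure lborel K"
          using \<open>e1 > 0\<close> by simp
        moreover have "f (Sup K) = f (Inf K)" if "(t, K) \<notin> q"
        proof -
          have "Sup K = Inf K"
            using that K[OF tK] True tK by (auto simp: q_def)
          then show ?thesis by simp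
        qed
        ultimately show ?thesis
          using True by (auto simp: g_def norm_minus_commute)
      next
        case False
        note K = K[OF tK]
        then have t: "t \<in> {a..b} - N" "Inf K \<in> {a..b}" "Sup K \<in> {a..b}"
          using False by auto
        have near: "\<bar>Inf K - t\<bar> < \<rho> t" "\<bar>Sup K - t\<bar> < \<rho> t"
        proof -
          have "{Inf K..Sup K} \<subseteq> ball t (\<rho> t)"
            using K t(1) by (auto simp: \<gamma>_def)
          moreover have "Inf K \<in> {Inf K..Sup K}" "Sup K \<in> {Inf K..Sup K}"
            using K by auto
          ultimately have "Inf K \<in> ball t (\<rho> t)" "Sup K \<in> ball t (\<rho> t)"
            by blast+
          then show "\<bar>Inf K - t\<bar> < \<rho> t" "\<bar>Sup K - t\<bar> < \<rho> t"
            by (auto simp: dist_real_def abs_minus_commute)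
        qed
        have "measure lborel K = Sup K - Inf K"
          by (subst K_Icc[OF tK]) (use K in simp)
        \<comment> \<open>The increment over \<open>K\<close> is split at the tag \<open>t\<close>,
          so that each half is a straddle error.\<close>
        then have "measure lborel K *\<^sub>R g t - (f (Sup K) - f (Inf K)) =
            (f (Inf K) - f t - (Inf K - t) *\<^sub>R f' t) - (f (Sup K) - f t - (Sup K - t) *\<^sub>R f' t)"
          using False by (simp add: g_def scaleR_diff_left)
        also have "norm \<dots> \<le> e1 * \<bar>Inf K - t\<bar> + e1 * \<bar>Sup K - t\<bar>"
          by (intro order.trans[OF norm_triangle_ineq4] add_mono \<rho>(2) t near)
        also have "\<dots> = e1 * measure lborel K"
        proof -
          have "\<bar>Inf K - t\<bar> = t - Inf K" "\<bar>Sup K - t\<bar> = Sup K - t"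
            using K by auto
          then show ?thesis
            by (simp add: \<open>measure lborel K = Sup K - Inf K\<close> right_diff_distrib)
        qed
        finally show ?thesis
          using False by (simp add: q_def)
      qed
      have "(\<Sum>(t, K)\<in>p. measure lborel K *\<^sub>R g t) - (f b - f a) =
          (\<Sum>(t, K)\<in>p. measure lborel K *\<^sub>R g t - (f (Sup K) - f (Inf K)))"
        using additive_tagged_division_1[OF \<open>a \<le> b\<close> p, of f]
        by (simp add: split_def sum_subtractf)
      also have "norm \<dots> \<le> (\<Sum>(t, K)\<in>p. e1 * measure lborel K + (if (t, K) \<in> q then norm (f (Sup K) - f (Inf K)) else 0))"
        using term_le by (intro sum_norm_le) auto
      also have "\<dots> = e1 * (\<Sum>(t, K)\<in>p. measure lborel K) + (\<Sum>(t, K)\<in>q. norm (f (Sup K) - f (Inf K)))"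
      proof -
        have "(\<Sum>x\<in>p. if x \<in> q then norm (f (Sup (snd x)) - f (Inf (snd x))) else 0) =
            (\<Sum>x\<in>q. norm (f (Sup (snd x)) - f (Inf (snd x))))"
          by (subst sum.inter_restrict[OF fin(1), symmetric]) (auto simp: q_def intro!: sum.cong)
        then show ?thesis
          by (simp add: split_def sum.distrib sum_distrib_left)
      qed
      also have "(\<Sum>(t, K)\<in>p. measure lborel K) = b - a"
        using additive_content_tagged_division[of p a b] p \<open>a \<le> b\<close> by (simp add: cbox_interval)
      also have "e1 * (b - a) + (\<Sum>(t, K)\<in>q. norm (f (Sup K) - f (Inf K))) < e"
        using e1 q_sum by linarith
      finally show ?thesis .
    qed
    ultimately show "\<exists>\<gamma>. gauge \<gamma> \<and> (\<forall>p. p tagged_division_of {a..b} \<and> \<gamma> fine p \<longrightarrow>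
        norm ((\<Sum>(t, K)\<in>p. measure lborel K *\<^sub>R g t) - (f b - f a)) < e)"
      by (intro exI[of _ \<gamma>] conjI allI impI) simp_all
  qed
  then show ?thesis
    by (rule has_integral_spike[OF N, rotated]) (simp add: g_def)
qed

section \<open>The predictor state\<close>

text \<open>The closed loop with bounded operators in place of matrices. The condition
  \<open>\<epsilon> \<le> r\<close> makes the actual delay \<open>r + \<epsilon> * d t\<close>
  nonnegative, so \<open>u\<close> is never read in the future.\<close>

locale predictor_feedback =
  fixes \<alpha> :: "'a::{banach, perfect_space} endo" and B :: "'b::real_normed_vector \<Rightarrow>\<^sub>L 'a"
    and k :: "'a \<Rightarrow>\<^sub>L 'b" and r \<epsilon> :: real and d :: "real \<Rightarrow> real"
    and x :: "real \<Rightarrow> 'a" and u :: "real \<Rightarrow> 'b"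
  assumes r_nonneg: "0 \<le> r" and \<epsilon>_nonneg: "0 \<le> \<epsilon>" and \<epsilon>_le_r: "\<epsilon> \<le> r"
    and d_bound: "\<And>t. 0 \<le> t \<Longrightarrow> \<bar>d t\<bar> \<le> 1"
    and x_ac: "\<And>b. abs_continuous_on {0..b} x"
    and u_cont: "continuous_on {- r - \<epsilon>..} u"
    and x_ode: "AE t in lebesgue_on {0..}.
      (x has_vector_derivative (endo_apply \<alpha> (x t) + B (u (t - r - \<epsilon> * d t)))) (at t)"
    and feedback: "\<And>t. 0 \<le> t \<Longrightarrow> u t = k (endo_apply (exp (r *\<^sub>R \<alpha>)) (x t) +
      integral {t..t + r} (\<lambda>s. endo_apply (exp ((t + r - s) *\<^sub>R \<alpha>)) (B (u (s - r)))))"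
begin

text \<open>The prediction of $x(t + r)$ that is exact when $d$ vanishes; the feedback is $u = k z$.\<close>

definition z :: "real \<Rightarrow> 'a" where
  "z t = endo_apply (exp (r *\<^sub>R \<alpha>)) (x t) +
     integral {t..t + r} (\<lambda>s. endo_apply (exp ((t + r - s) *\<^sub>R \<alpha>)) (B (u (s - r))))"

definition M :: "'a endo" where
  "M = \<alpha> + Endo (B o\<^sub>L k)"

text \<open>The perturbation that the delay uncertainty adds to the nominal dynamics $z' = M z$.\<close>

definition v :: "real \<Rightarrow> 'a" where
  "v t = endo_apply (exp (r *\<^sub>R \<alpha>)) (B (u (t - r - \<epsilon> * d t) - u (t - r)))"

lemma u_eq: "0 \<le> t \<Longrightarrow> u t = k (z t)"
  by (simp add: z_def feedback)

lemma endo_apply_M: "endo_apply M y = endo_apply \<alpha> y + B (k y)"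
  by (simp add: M_def endo_apply.add_left)

text \<open>Splitting the kernel as $e^{(t - s)\<alpha>} = e^{t\<alpha>} e^{-s\<alpha>}$ turns the distributed delay in
  $z$ into a difference of values of one antiderivative.\<close>

definition h :: "real \<Rightarrow> 'a" where
  "h s = endo_apply (exp (- s *\<^sub>R \<alpha>)) (B (u s))"

lemma h_cont: "continuous_on {- r - \<epsilon>..} h"
  unfolding h_def
  by (intro endo_apply.continuous_on continuous_on_exp_scaleR continuous_intros u_cont)

definition F :: "real \<Rightarrow> 'a" where
  "F t = integral {- r..t} h"

lemma z_eq:
  assumes "0 \<le> t"
  shows "z t = endo_apply (exp (r *\<^sub>R \<alpha>)) (x t) + endo_apply (exp (t *\<^sub>R \<alpha>)) (F t - F (t - r))"
proof -
  have int: "h integrable_on {c..d}" if "- r - \<epsilon> \<le> c" for c d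
    using that by (intro integrable_continuous_real continuous_on_subset[OF h_cont]) auto
  \<comment> \<open>The exponent \<open>t + r - s\<close> equals \<open>t - (s - r)\<close>: after
    the shift by \<open>r\<close> the kernel is the constant factor
    \<open>exp (t *\<^sub>R \<alpha>)\<close> applied to \<open>h\<close>.\<close>
  have "integral {t..t + r} (\<lambda>s. endo_apply (exp ((t + r - s) *\<^sub>R \<alpha>)) (B (u (s - r)))) =
      integral {t - r - - r..t - - r} (\<lambda>s. endo_apply (exp (t *\<^sub>R \<alpha>)) (h (s + - r)))"
    by (rule integral_cong[THEN trans]) (auto simp: h_def add_diff_eq simp flip: exp_scaleR_add endo_apply_times)
  also have "\<dots> = integral {t - r..t} (\<lambda>s. endo_apply (exp (t *\<^sub>R \<alpha>)) (h s))"
    by (rule integral_shift_real_ivl)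
  also have "\<dots> = endo_apply (exp (t *\<^sub>R \<alpha>)) (integral {t - r..t} h)"
    using integral_linear[OF int endo_apply.bounded_linear_right, of "t - r" t] assms \<epsilon>_nonneg
    by (simp add: o_def)
  also have "integral {t - r..t} h = F t - F (t - r)"
    using Henstock_Kurzweil_Integration.integral_combine[of "- r" "t - r" t h] int[of "- r" t] assms r_nonneg \<epsilon>_nonneg
    unfolding F_def by (simp add: algebra_simps)
  finally show ?thesis
    by (simp add: z_def)
qed

lemma F_deriv:
  assumes "0 \<le> t"
  shows "(F has_vector_derivative h t) (at t within {0..b})"
    and "((\<lambda>t. F (t - r)) has_vector_derivative h (t - r)) (at t within {0..b})"
proof -
  \<comment> \<open>The end point \<open>c\<close> is free; \<open>t + \<bar>b\<bar>\<close> will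
    serve, as it exceeds both \<open>t\<close> and \<open>b\<close> in whichever order they
    stand.\<close>
  have deriv: "(F has_vector_derivative h s) (at s within S)"
    if "- r \<le> s" "s \<le> c" "S \<subseteq> {- r..c}" for s c S
  proof -
    have "continuous_on {- r..c} h"
      using \<epsilon>_nonneg by (intro continuous_on_subset[OF h_cont]) auto
    then have "(F has_vector_derivative h s) (at s within {- r..c})"
      unfolding F_def using that by (intro integral_has_vector_derivative) auto
    then show ?thesis
      by (rule has_vector_derivative_within_subset) (use that in auto)
  qed
  show "(F has_vector_derivative h t) (at t within {0..b})"
    using assms r_nonneg by (intro deriv[of _ "t + \<bar>b\<bar>"]) auto
  have "((\<lambda>t. t - r) has_vector_derivative 1) (at t within {0..b})"
    by (auto intro!: derivative_eq_intros)
  from vector_diff_chain_within[OF this deriv[of _ "t + \<bar>b\<bar>"]] assms r_nonneg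
  show "((\<lambda>t. F (t - r)) has_vector_derivative h (t - r)) (at t within {0..b})"
    by (auto simp: o_def image_subset_iff)
qed

text \<open>By \<open>z_eq\<close>, on nonnegative times \<open>z\<close> is built from
  \<open>x\<close> and continuously differentiable functions by sums and bilinear application.
  Domination with constant 1 then transfers the property from that formula to
  \<open>z\<close>.\<close>

lemma z_ac: "abs_continuous_on {0..b} z"
proof -
  have const: "abs_continuous_on {0..b} (\<lambda>t. c)" for c :: "'a endo"
    by (rule abs_continuous_on_has_vector_derivative[of _ _ _ "\<lambda>_. 0"]) (auto intro: has_vector_derivative_const)
  have "abs_continuous_on {0..b} (\<lambda>t. exp (t *\<^sub>R \<alpha>))"
    by (rule abs_continuous_on_has_vector_derivative[OF exp_scaleR_has_vector_derivative_right])
      (intro continuous_intros)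
  moreover have "abs_continuous_on {0..b} (\<lambda>t. F t - F (t - r))"
    by (rule abs_continuous_on_has_vector_derivative[OF has_vector_derivative_diff[OF F_deriv]])
      (use r_nonneg \<epsilon>_nonneg in \<open>auto intro!: continuous_intros continuous_on_subset[OF h_cont]
        continuous_on_compose2[OF h_cont]\<close>)
  ultimately have "abs_continuous_on {0..b}
      (\<lambda>t. endo_apply (exp (r *\<^sub>R \<alpha>)) (x t) + endo_apply (exp (t *\<^sub>R \<alpha>)) (F t - F (t - r)))"
    by (intro abs_continuous_on_add endo_apply.abs_continuous_on const x_ac)
  from abs_continuous_on_dominated[OF this this, of z 1] show ?thesis
    by (force simp: z_eq)
qed

text \<open>Off the exceptional set of the equation for \<open>x\<close>, differentiating
  \<open>F t - F (t - r)\<close> yields \<open>B (u t)\<close> and a multiple of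
  \<open>B (u (t - r))\<close>. The latter turns the delayed input into \<open>v\<close>, the former
  is \<open>B (k (z t))\<close>, and \<alpha> commutes with its exponentials, which collects the
  rest into \<alpha> applied to \<open>z\<close>.\<close>

lemma z_ode:
  obtains N where "negligible N"
    "\<And>t. \<lbrakk>t \<in> {0..} - N; t \<in> {0..b}\<rbrakk> \<Longrightarrow> (z has_vector_derivative (endo_apply M (z t) + v t)) (at t within {0..b})"
proof -
  have "AE t in lebesgue. t \<in> {0..} \<longrightarrow>
      (x has_vector_derivative (endo_apply \<alpha> (x t) + B (u (t - r - \<epsilon> * d t)))) (at t)"
    using x_ode by (subst (asm) AE_restrict_space_iff) auto
  then obtain N where N: "N \<in> null_sets lebesgue"
    "\<And>t. t \<in> {0..} - N \<Longrightarrow> (x has_vector_derivative (endo_apply \<alpha> (x t) + B (u (t - r - \<epsilon> * d t)))) (at t)"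
    by (rule AE_E3) auto
  have "(z has_vector_derivative (endo_apply M (z t) + v t)) (at t within {0..b})"
    if "t \<in> {0..} - N" "t \<in> {0..b}" for t
  proof -
    have t: "0 \<le> t"
      using that by auto
    let ?E = "endo_apply (exp (t *\<^sub>R \<alpha>))" and ?R = "endo_apply (exp (r *\<^sub>R \<alpha>))"
    have "((\<lambda>t. ?R (x t) + endo_apply (exp (t *\<^sub>R \<alpha>)) (F t - F (t - r))) has_vector_derivative
        ?R (endo_apply \<alpha> (x t) + B (u (t - r - \<epsilon> * d t))) +
        (?E (h t - h (t - r)) + endo_apply (exp (t *\<^sub>R \<alpha>) * \<alpha>) (F t - F (t - r)))) (at t within {0..b})"
      by (intro has_vector_derivative_add endo_apply.has_vector_derivative has_vector_derivative_diff
          F_deriv t exp_scaleR_has_vector_derivative_right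
          bounded_linear.has_vector_derivative[OF endo_apply.bounded_linear_right]
          has_vector_derivative_at_within[OF N(2)[OF that(1)]])
    also have "?R (endo_apply \<alpha> (x t) + B (u (t - r - \<epsilon> * d t))) +
        (?E (h t - h (t - r)) + endo_apply (exp (t *\<^sub>R \<alpha>) * \<alpha>) (F t - F (t - r))) =
        endo_apply M (z t) + v t"
    proof -
      have "?E (h t) = B (u t)" "?E (h (t - r)) = ?R (B (u (t - r)))"
        by (simp_all add: h_def exp_minus_inverse flip: exp_scaleR_add endo_apply_times)
      moreover have "?R (endo_apply \<alpha> y) = endo_apply \<alpha> (?R y)" "?E (endo_apply \<alpha> y) = endo_apply \<alpha> (?E y)" for y
        by (simp_all add: exp_times_scaleR_commute flip: endo_apply_times)
      ultimately show ?thesis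
        by (simp add: endo_apply_M v_def z_eq[OF t, symmetric] u_eq[OF t, symmetric] endo_apply.add_right endo_apply.diff_right
            exp_times_scaleR_commute blinfun.diff_right)
         (simp add: z_eq[OF t] endo_apply.add_right endo_apply.diff_right)
    qed
    finally show ?thesis
      by (rule has_vector_derivative_transform[rotated 2]) (use that in \<open>auto simp: z_eq\<close>)
  qed
  moreover have "negligible N"
    using N(1) by (simp add: negligible_iff_null_sets)
  ultimately show ?thesis
    by (rule that[rotated])
qed

text \<open>Differentiating \<open>exp ((b - s) *\<^sub>R M)\<close> applied to \<open>z s\<close>
  cancels the drift and leaves the forcing term. As \<open>z\<close> is differentiable only almost
  everywhere, the absolutely continuous form of the fundamental theorem is used; it yields
  integrability of the forcing term as well.\<close>

lemma variation_of_constants: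
  assumes "0 \<le> a" "a \<le> b"
  shows "((\<lambda>s. endo_apply (exp ((b - s) *\<^sub>R M)) (v s)) has_integral
    z b - endo_apply (exp ((b - a) *\<^sub>R M)) (z a)) {a..b}"
proof -
  obtain N where N: "negligible N"
    "\<And>t. \<lbrakk>t \<in> {0..} - N; t \<in> {0..b}\<rbrakk> \<Longrightarrow> (z has_vector_derivative (endo_apply M (z t) + v t)) (at t within {0..b})"
    using z_ode by blast
  let ?y = "\<lambda>s. endo_apply (exp ((b - s) *\<^sub>R M)) (z s)"
  have "abs_continuous_on {a..b} z"
    by (rule abs_continuous_on_subset[OF z_ac[of b]]) (use \<open>0 \<le> a\<close> in auto)
  moreover have "abs_continuous_on {a..b} (\<lambda>s. exp ((b - s) *\<^sub>R M))"
    by (rule abs_continuous_on_has_vector_derivative[OF has_vector_derivative_exp_reflected])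
      (intro continuous_intros)
  ultimately have ac: "abs_continuous_on {a..b} ?y"
    by (intro endo_apply.abs_continuous_on)
  have "((\<lambda>s. endo_apply (exp ((b - s) *\<^sub>R M)) (v s)) has_integral ?y b - ?y a) {a..b}"
  proof (rule fundamental_theorem_of_calculus_abs_continuous[OF \<open>a \<le> b\<close> ac N(1)])
    fix t assume t: "t \<in> {a..b} - N"
    with \<open>0 \<le> a\<close> have "(?y has_vector_derivative
        endo_apply (exp ((b - t) *\<^sub>R M)) (endo_apply M (z t) + v t) +
        endo_apply (- (exp ((b - t) *\<^sub>R M) * M)) (z t)) (at t within {a..b})"
      by (intro endo_apply.has_vector_derivative has_vector_derivative_exp_reflected
          has_vector_derivative_within_subset[OF N(2)]) auto
    then show "(?y has_vector_derivative endo_apply (exp ((b - t) *\<^sub>R M)) (v t)) (at t within {a..b})"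
      by (simp add: endo_apply.add_right endo_apply.minus_left)
  qed
  then show ?thesis
    by simp
qed

lemma z_bounded: "bounded (z ` {0..b})"
  by (intro compact_imp_bounded compact_continuous_image abs_continuous_on_imp_continuous_on z_ac compact_Icc)

text \<open>Used in both directions: to bound \<open>z 0\<close> by the initial data, and to recover
  \<open>x\<close> from \<open>z\<close> at the end.\<close>

lemma norm_z_minus_le:
  assumes "0 \<le> t" and U: "\<And>s. s \<in> {t - r..t} \<Longrightarrow> norm (u s) \<le> U"
  shows "norm (z t - endo_apply (exp (r *\<^sub>R \<alpha>)) (x t)) \<le> r * exp (r * norm \<alpha>) * norm B * U"
proof -
  have "0 \<le> U"
    using order.trans[OF norm_ge_zero U[of t]] r_nonneg by simp
  have "norm (integral {t..t + r} (\<lambda>s. endo_apply (exp ((t + r - s) *\<^sub>R \<alpha>)) (B (u (s - r)))))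
      \<le> (exp (r * norm \<alpha>) * (norm B * U)) * (t + r - t)"
  proof (rule integral_bound)
    show "continuous_on {t..t + r} (\<lambda>s. endo_apply (exp ((t + r - s) *\<^sub>R \<alpha>)) (B (u (s - r))))"
      using assms(1) \<epsilon>_nonneg r_nonneg
      by (intro endo_apply.continuous_on continuous_intros continuous_on_compose2[OF u_cont]) auto
    fix s assume s: "s \<in> {t..t + r}"
    have "norm (exp ((t + r - s) *\<^sub>R \<alpha>)) \<le> exp (r * norm \<alpha>)"
      using s by (intro order.trans[OF norm_exp]) (auto intro: mult_right_mono)
    moreover have "norm (B (u (s - r))) \<le> norm B * U"
      using s by (intro order.trans[OF norm_blinfun] mult_left_mono U) auto
    ultimately show "norm (endo_apply (exp ((t + r - s) *\<^sub>R \<alpha>)) (B (u (s - r)))) \<le> exp (r * norm \<alpha>) * (norm B * U)"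
      by (intro order.trans[OF norm_endo_apply_le] mult_mono) auto
  qed (use r_nonneg in auto)
  then show ?thesis
    by (simp add: z_def algebra_simps)
qed

end

section \<open>Small-gain estimates\<close>

text \<open>Apply the step to the least bound, the supremum \<open>V\<close>; since \<open>V\<close>
  is finite, \<open>\<rho> * V\<close> can be absorbed on the left.\<close>

lemma bounded_function_le_of_contractive_bound:
  fixes \<phi> :: "'c \<Rightarrow> real"
  assumes bdd: "bdd_above (\<phi> ` S)" and "\<rho> < 1"
    and step: "\<And>V t. (\<And>s. s \<in> S \<Longrightarrow> \<phi> s \<le> V) \<Longrightarrow> t \<in> S \<Longrightarrow> \<phi> t \<le> K + \<rho> * V"
    and "t \<in> S"
  shows "\<phi> t \<le> K / (1 - \<rho>)"
proof -
  define V where "V = (SUP s\<in>S. \<phi> s)"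
  have le: "\<phi> s \<le> V" if "s \<in> S" for s
    unfolding V_def by (rule cSUP_upper[OF that bdd])
  have "V \<le> K + \<rho> * V"
    by (subst V_def, rule cSUP_least) (use \<open>t \<in> S\<close> step[OF le] in auto)
  then have "V \<le> K / (1 - \<rho>)"
    using \<open>\<rho> < 1\<close> by (simp add: field_simps)
  with le[OF \<open>t \<in> S\<close>] show ?thesis
    by simp
qed

text \<open>The differential equation enters these estimates only through its variation-of-constants
  formula.\<close>

context
  fixes M :: "'a::{banach, perfect_space} endo" and \<Theta> l :: real and z v :: "real \<Rightarrow> 'a"
  assumes \<Theta>_nonneg: "0 \<le> \<Theta>"
    and decay: "\<And>t. 0 \<le> t \<Longrightarrow> norm (exp (t *\<^sub>R M)) \<le> \<Theta> * exp (- l * t)"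
    and voc: "\<And>a b. \<lbrakk>0 \<le> a; a \<le> b\<rbrakk> \<Longrightarrow> ((\<lambda>s. endo_apply (exp ((b - s) *\<^sub>R M)) (v s)) has_integral
      z b - endo_apply (exp ((b - a) *\<^sub>R M)) (z a)) {a..b}"
begin

text \<open>Integrates the decaying kernel against the weighted bound on \<open>v\<close>. The last
  factor keeps track of the length of the interval, which makes short increments of \<open>z\<close>
  cheap. A negative \<sigma>, that is a growing weight, is allowed.\<close>

lemma forced_response_le:
  assumes "0 \<le> a" "a \<le> b" "\<sigma> < l"
    and V: "\<And>s. s \<in> {a..b} \<Longrightarrow> norm (v s) \<le> V * exp (- \<sigma> * s)"
  shows "norm (z b - endo_apply (exp ((b - a) *\<^sub>R M)) (z a)) \<le>
    \<Theta> * V * exp (- \<sigma> * b) * (1 - exp (- (l - \<sigma>) * (b - a))) / (l - \<sigma>)"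
proof -
  define g where "g s = \<Theta> * V * exp (- l * b) * exp ((l - \<sigma>) * s)" for s
  have "(g has_integral \<Theta> * V * exp (- l * b) * exp ((l - \<sigma>) * b) / (l - \<sigma>) -
      \<Theta> * V * exp (- l * b) * exp ((l - \<sigma>) * a) / (l - \<sigma>)) {a..b}"
    unfolding g_def using \<open>\<sigma> < l\<close>
    by (intro fundamental_theorem_of_calculus \<open>a \<le> b\<close>)
      (auto simp flip: has_real_derivative_iff_has_vector_derivative intro!: derivative_eq_intros)
  then have "norm (z b - endo_apply (exp ((b - a) *\<^sub>R M)) (z a)) \<le>
      \<Theta> * V * exp (- l * b) * exp ((l - \<sigma>) * b) / (l - \<sigma>) - \<Theta> * V * exp (- l * b) * exp ((l - \<sigma>) * a) / (l - \<sigma>)"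
  proof -
    have "norm (endo_apply (exp ((b - s) *\<^sub>R M)) (v s)) \<le> g s" if "s \<in> {a..b}" for s
    proof -
      have "norm (endo_apply (exp ((b - s) *\<^sub>R M)) (v s)) \<le> (\<Theta> * exp (- l * (b - s))) * (V * exp (- \<sigma> * s))"
        using that \<Theta>_nonneg by (intro order.trans[OF norm_endo_apply_le] mult_mono decay V) auto
      also have "\<dots> = g s"
        by (simp add: g_def algebra_simps flip: exp_add)
      finally show ?thesis .
    qed
    with has_integral_norm_bound_integral_component[OF voc[OF \<open>0 \<le> a\<close> \<open>a \<le> b\<close>]
        \<open>(g has_integral _) _\<close>, of 1]
    show ?thesis
      by (simp only: inner_real_def mult_1_right)
  qed
  also have "\<dots> = \<Theta> * V * exp (- \<sigma> * b) * (1 - exp (- (l - \<sigma>) * (b - a))) / (l - \<sigma>)"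
    by (simp add: diff_divide_distrib right_diff_distrib algebra_simps flip: exp_add)
  finally show ?thesis .
qed

text \<open>The forced response from time 0, with its length factor bounded by 1, plus the free
  motion with its rate \<open>l\<close> weakened to \<sigma>.\<close>

lemma state_le:
  assumes "0 \<le> t" "\<sigma> < l"
    and V: "\<And>s. s \<in> {0..t} \<Longrightarrow> norm (v s) \<le> V * exp (- \<sigma> * s)"
  shows "norm (z t) \<le> exp (- \<sigma> * t) * (\<Theta> * norm (z 0) + \<Theta> * V / (l - \<sigma>))"
proof -
  have "0 \<le> V"
    using order.trans[OF norm_ge_zero V[of 0]] assms(1) by simp
  have "norm (z t) \<le> norm (endo_apply (exp (t *\<^sub>R M)) (z 0)) + norm (z t - endo_apply (exp ((t - 0) *\<^sub>R M)) (z 0))"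
    by (metis diff_zero norm_triangle_sub)
  also have "norm (endo_apply (exp (t *\<^sub>R M)) (z 0)) \<le> (\<Theta> * exp (- l * t)) * norm (z 0)"
    by (intro order.trans[OF norm_endo_apply_le] mult_right_mono decay assms) auto
  also have "\<dots> \<le> (\<Theta> * exp (- \<sigma> * t)) * norm (z 0)"
    using assms \<Theta>_nonneg by (intro mult_right_mono mult_left_mono) (auto intro: mult_right_mono)
  also have "norm (z t - endo_apply (exp ((t - 0) *\<^sub>R M)) (z 0)) \<le>
      \<Theta> * V * exp (- \<sigma> * t) * (1 - exp (- (l - \<sigma>) * (t - 0))) / (l - \<sigma>)"
    by (rule forced_response_le) (use assms in auto)
  also have "\<dots> \<le> \<Theta> * V * exp (- \<sigma> * t) * 1 / (l - \<sigma>)"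
    using assms \<Theta>_nonneg \<open>0 \<le> V\<close> by (intro divide_right_mono mult_left_mono) auto
  finally show ?thesis
    by (simp add: algebra_simps)
qed

text \<open>With weight \<open>exp (\<sigma> * t)\<close> the loop from \<open>v\<close> through
  increments of \<open>z\<close> back to \<open>v\<close> has gain \<rho>. An increment consists of
  a free part, at most \<kappa> times the norm of \<open>z a\<close>, and a forced response over a
  length at most \<epsilon>. Up to time \<open>h\<close> the bound \<open>D\<close> replaces the
  loop.\<close>

lemma small_gain:
  assumes kappa: "\<And>\<tau>. \<lbrakk>0 \<le> \<tau>; \<tau> \<le> \<epsilon>\<rbrakk> \<Longrightarrow> norm (exp (\<tau> *\<^sub>R M) - 1) \<le> \<kappa>"
    and delay: "\<And>t. h \<le> t \<Longrightarrow> \<exists>a b. 0 \<le> a \<and> t - h \<le> a \<and> a \<le> b \<and> b \<le> t \<and> b - a \<le> \<epsilon> \<and>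
      norm (v t) \<le> \<gamma> * norm (z b - z a)"
    and "0 \<le> \<epsilon>" "0 \<le> h" "0 \<le> \<gamma>" "0 \<le> \<sigma>" "\<sigma> < l"
    and bdd: "\<And>\<tau>. bounded (v ` {0..\<tau>})"
    and early: "\<And>t. t \<in> {0..h} \<Longrightarrow> norm (v t) \<le> D"
    and \<rho>: "\<rho> = exp (\<sigma> * h) * (\<gamma> * \<Theta> * (\<kappa> + 1 - exp (- (l - \<sigma>) * \<epsilon>)) / (l - \<sigma>))" "\<rho> < 1"
    and "0 \<le> t"
  shows "norm (v t) \<le> exp (\<sigma> * h) * (D + \<gamma> * \<kappa> * \<Theta> * norm (z 0)) / (1 - \<rho>) * exp (- \<sigma> * t)"
proof -
  have "0 \<le> \<kappa>"
    using order.trans[OF norm_ge_zero kappa[of 0]] \<open>0 \<le> \<epsilon>\<close> by simp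
  have "0 \<le> D"
    using order.trans[OF norm_ge_zero early[of 0]] \<open>0 \<le> h\<close> by simp
  have "exp (- (l - \<sigma>) * \<epsilon>) \<le> 1"
    using \<open>\<sigma> < l\<close> \<open>0 \<le> \<epsilon>\<close> by (simp add: mult_nonpos_nonneg)
  with \<open>0 \<le> \<kappa>\<close> have gap: "0 \<le> \<kappa> + 1 - exp (- (l - \<sigma>) * \<epsilon>)"
    by linarith
  then have "\<rho> \<ge> 0"
    unfolding \<rho> using \<open>0 \<le> \<gamma>\<close> \<open>0 \<le> \<kappa>\<close> \<open>\<sigma> < l\<close> \<open>0 \<le> \<epsilon>\<close> \<Theta>_nonneg
    by (intro mult_nonneg_nonneg divide_nonneg_pos) auto
  define \<phi> where "\<phi> s = exp (\<sigma> * s) * norm (v s)" for s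
  have "\<phi> t \<le> exp (\<sigma> * h) * (D + \<gamma> * \<kappa> * \<Theta> * norm (z 0)) / (1 - \<rho>)"
  proof (rule bounded_function_le_of_contractive_bound[where S = "{0..t}" and \<phi> = \<phi>])
    obtain C where C: "\<And>s. s \<in> {0..t} \<Longrightarrow> norm (v s) \<le> C"
      using bdd[of t] unfolding bounded_iff by blast
    show "bdd_above (\<phi> ` {0..t})"
    proof (rule bdd_aboveI2)
      show "\<phi> s \<le> exp (\<sigma> * t) * C" if "s \<in> {0..t}" for s
        unfolding \<phi>_def using that C[OF that] \<open>0 \<le> \<sigma>\<close>
        by (intro mult_mono) (auto intro: mult_left_mono)
    qed
    fix V s assume le: "\<And>s. s \<in> {0..t} \<Longrightarrow> \<phi> s \<le> V" and s: "s \<in> {0..t}"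
    have V: "norm (v s) \<le> V * exp (- \<sigma> * s)" if "s \<in> {0..t}" for s
      using le[OF that] by (simp add: \<phi>_def exp_minus field_simps)
    have "0 \<le> \<phi> 0"
      by (simp add: \<phi>_def)
    also have "\<phi> 0 \<le> V"
      using le \<open>0 \<le> t\<close> by simp
    finally have "0 \<le> V" .
    show "\<phi> s \<le> exp (\<sigma> * h) * (D + \<gamma> * \<kappa> * \<Theta> * norm (z 0)) + \<rho> * V"
    proof (cases "s \<le> h")
      case True
      then have "\<phi> s \<le> exp (\<sigma> * h) * D"
        unfolding \<phi>_def using s early[of s] \<open>0 \<le> \<sigma>\<close> by (intro mult_mono) (auto intro: mult_left_mono)
      also have "\<dots> \<le> exp (\<sigma> * h) * (D + \<gamma> * \<kappa> * \<Theta> * norm (z 0)) + \<rho> * V"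
        using \<open>0 \<le> \<rho>\<close> \<open>0 \<le> V\<close> \<open>0 \<le> \<gamma>\<close> \<open>0 \<le> \<kappa>\<close> \<Theta>_nonneg by (simp add: algebra_simps)
      finally show ?thesis .
    next
      case False
      then obtain a b where ab: "0 \<le> a" "s - h \<le> a" "a \<le> b" "b \<le> s" "b - a \<le> \<epsilon>"
        "norm (v s) \<le> \<gamma> * norm (z b - z a)"
        using delay[of s] by auto
      have V': "norm (v q) \<le> V * exp (- \<sigma> * q)" if "q \<in> {0..b}" for q
        using that s ab by (intro V) auto
      have "z b - z a = (z b - endo_apply (exp ((b - a) *\<^sub>R M)) (z a)) + endo_apply (exp ((b - a) *\<^sub>R M) - 1) (z a)"
        by (simp add: endo_apply.diff_left)
      then have "norm (z b - z a) \<le> norm (z b - endo_apply (exp ((b - a) *\<^sub>R M)) (z a)) +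
          norm (endo_apply (exp ((b - a) *\<^sub>R M) - 1) (z a))"
        by (metis norm_triangle_ineq)
      also have "norm (z b - endo_apply (exp ((b - a) *\<^sub>R M)) (z a)) \<le>
          \<Theta> * V * exp (- \<sigma> * b) * (1 - exp (- (l - \<sigma>) * (b - a))) / (l - \<sigma>)"
        by (rule forced_response_le) (use ab \<open>\<sigma> < l\<close> V' in auto)
      \<comment> \<open>The length is replaced by its worst case \<epsilon> and the weight moved
        from \<open>b\<close> to the earlier time \<open>a\<close>, where the free part is weighted
        too.\<close>
      also have "\<dots> \<le> \<Theta> * V * exp (- \<sigma> * a) * (1 - exp (- (l - \<sigma>) * \<epsilon>)) / (l - \<sigma>)"
        using ab \<open>\<sigma> < l\<close> \<open>0 \<le> \<sigma>\<close> \<Theta>_nonneg \<open>0 \<le> V\<close>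
        by (intro divide_right_mono mult_mono mult_nonneg_nonneg)
          (auto intro!: mult_left_mono simp: mult_nonpos_nonneg)
      also have "norm (endo_apply (exp ((b - a) *\<^sub>R M) - 1) (z a)) \<le>
          \<kappa> * (exp (- \<sigma> * a) * (\<Theta> * norm (z 0) + \<Theta> * V / (l - \<sigma>)))"
        using ab \<open>\<sigma> < l\<close> V' \<open>0 \<le> \<kappa>\<close>
        by (intro order.trans[OF norm_endo_apply_le] mult_mono kappa state_le) auto
      finally have "norm (z b - z a) \<le> \<Theta> * V * exp (- \<sigma> * a) * (1 - exp (- (l - \<sigma>) * \<epsilon>)) / (l - \<sigma>) +
          \<kappa> * (exp (- \<sigma> * a) * (\<Theta> * norm (z 0) + \<Theta> * V / (l - \<sigma>)))"
        by simp
      also have "\<dots> = exp (- \<sigma> * a) * (\<kappa> * \<Theta> * norm (z 0) +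
          \<Theta> * (\<kappa> + 1 - exp (- (l - \<sigma>) * \<epsilon>)) / (l - \<sigma>) * V)"
        by (simp add: add_divide_distrib diff_divide_distrib algebra_simps)
      finally have "\<phi> s \<le> exp (\<sigma> * s) * (\<gamma> * (exp (- \<sigma> * a) * (\<kappa> * \<Theta> * norm (z 0) +
          \<Theta> * (\<kappa> + 1 - exp (- (l - \<sigma>) * \<epsilon>)) / (l - \<sigma>) * V)))"
        unfolding \<phi>_def using \<open>0 \<le> \<gamma>\<close> by (intro mult_left_mono order.trans[OF ab(6)]) auto
      also have "\<dots> = exp (\<sigma> * (s - a)) * (\<gamma> * \<kappa> * \<Theta> * norm (z 0) +
          \<gamma> * \<Theta> * (\<kappa> + 1 - exp (- (l - \<sigma>) * \<epsilon>)) / (l - \<sigma>) * V)"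
        by (simp add: right_diff_distrib exp_diff exp_minus field_simps)
      \<comment> \<open>Source of the factor \<open>exp (\<sigma> * h)\<close> in \<rho>: the
        increment starts at most \<open>h\<close> before \<open>s\<close>.\<close>
      also have "\<dots> \<le> exp (\<sigma> * h) * (\<gamma> * \<kappa> * \<Theta> * norm (z 0) +
          \<gamma> * \<Theta> * (\<kappa> + 1 - exp (- (l - \<sigma>) * \<epsilon>)) / (l - \<sigma>) * V)"
        using ab gap \<open>0 \<le> \<gamma>\<close> \<open>0 \<le> \<kappa>\<close> \<open>\<sigma> < l\<close> \<open>0 \<le> \<epsilon>\<close> \<open>0 \<le> \<sigma>\<close> \<open>0 \<le> V\<close> \<Theta>_nonneg
        by (intro mult_right_mono add_nonneg_nonneg mult_nonneg_nonneg divide_nonneg_pos) (auto intro: mult_left_mono)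
      also have "\<dots> = exp (\<sigma> * h) * (\<gamma> * \<kappa> * \<Theta> * norm (z 0)) + \<rho> * V"
        by (simp add: \<rho> algebra_simps)
      also have "\<dots> \<le> exp (\<sigma> * h) * (D + \<gamma> * \<kappa> * \<Theta> * norm (z 0)) + \<rho> * V"
        using \<open>0 \<le> D\<close> by simp
      finally show ?thesis .
    qed
  qed (use \<rho> \<open>0 \<le> t\<close> in auto)
  then have "exp (- \<sigma> * t) * \<phi> t \<le> exp (- \<sigma> * t) * (exp (\<sigma> * h) * (D + \<gamma> * \<kappa> * \<Theta> * norm (z 0)) / (1 - \<rho>))"
    by (rule mult_left_mono) simp
  moreover have "exp (- \<sigma> * t) * \<phi> t = norm (v t)"
    by (simp add: \<phi>_def flip: exp_add mult.assoc)
  ultimately show ?thesis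
    by (simp only: mult.commute)
qed

end

text \<open>At \<open>\<sigma> = 0\<close> the claim is the strict hypothesis divided by
  \<open>l\<close>; continuity keeps it true for small positive \<sigma>.\<close>

lemma exists_decay_rate:
  fixes g \<kappa> \<epsilon> h l :: real
  assumes "0 < l" and gain: "g * (\<kappa> + 1 - exp (- l * \<epsilon>)) < l"
  obtains \<sigma> where "0 < \<sigma>" "\<sigma> < l" "exp (\<sigma> * h) * (g * (\<kappa> + 1 - exp (- (l - \<sigma>) * \<epsilon>)) / (l - \<sigma>)) < 1"
proof -
  let ?f = "\<lambda>\<sigma>. exp (\<sigma> * h) * (g * (\<kappa> + 1 - exp (- (l - \<sigma>) * \<epsilon>)) / (l - \<sigma>))"
  have "(?f \<longlongrightarrow> ?f 0) (at_right 0)"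
    using \<open>0 < l\<close> by (intro tendsto_intros) auto
  moreover have "?f 0 < 1"
    using assms by (simp add: field_simps)
  ultimately have "\<forall>\<^sub>F \<sigma> in at_right 0. ?f \<sigma> < 1"
    by (rule order_tendstoD)
  moreover have "\<forall>\<^sub>F \<sigma> in at_right 0. \<sigma> \<in> {0<..<l}"
    using \<open>0 < l\<close> by (rule eventually_at_right_real)
  ultimately have "\<forall>\<^sub>F \<sigma> in at_right 0. ?f \<sigma> < 1 \<and> \<sigma> \<in> {0<..<l}"
    by eventually_elim simp
  then obtain \<sigma> where "?f \<sigma> < 1 \<and> \<sigma> \<in> {0<..<l}"
    using eventually_happens[of _ "at_right (0 :: real)"] by (auto simp: trivial_limit_at_right_real)
  with that show ?thesis
    by auto
qed

section \<open>Exponential stability\<close>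

context predictor_feedback
begin

text \<open>A crude bound valid from time 0, while the delayed times may still fall into the initial
  segment where \<open>u\<close> is prescribed.\<close>

lemma norm_v_le:
  assumes "0 \<le> t" and U: "\<And>s. s \<in> {- r - \<epsilon>..t} \<Longrightarrow> norm (u s) \<le> U"
  shows "norm (v t) \<le> norm (exp (r *\<^sub>R \<alpha>)) * norm B * (2 * U)"
proof -
  have "\<bar>\<epsilon> * d t\<bar> \<le> \<epsilon>"
    using d_bound[OF \<open>0 \<le> t\<close>] \<epsilon>_nonneg by (simp add: abs_mult mult_left_le)
  then have "norm (u (t - r - \<epsilon> * d t)) \<le> U" "norm (u (t - r)) \<le> U"
    using \<open>0 \<le> t\<close> r_nonneg \<epsilon>_nonneg \<epsilon>_le_r by (intro U; auto simp: abs_le_iff)+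
  then have "norm (u (t - r - \<epsilon> * d t) - u (t - r)) \<le> 2 * U"
    by (intro order.trans[OF norm_triangle_ineq4]) simp
  then have "norm (B (u (t - r - \<epsilon> * d t) - u (t - r))) \<le> norm B * (2 * U)"
    by (intro order.trans[OF norm_blinfun] mult_left_mono) auto
  then show ?thesis
    unfolding v_def mult.assoc by (intro order.trans[OF norm_endo_apply_le] mult_left_mono) auto
qed

text \<open>From time \<open>r + \<epsilon>\<close> on, both delayed times are nonnegative, so
  \<open>u\<close> is \<open>k\<close> applied to \<open>z\<close> at each. They are sorted by
  \<open>min\<close> and \<open>max\<close> because the sign of \<open>d t\<close> is
  unknown.\<close>

lemma norm_v_le_diff:
  assumes "r + \<epsilon> \<le> t"
  shows "\<exists>a b. 0 \<le> a \<and> t - (r + \<epsilon>) \<le> a \<and> a \<le> b \<and> b \<le> t \<and> b - a \<le> \<epsilon> \<and>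
    norm (v t) \<le> norm (exp (r *\<^sub>R \<alpha>) * Endo (B o\<^sub>L k)) * norm (z b - z a)"
proof -
  define p q where "p = t - r - \<epsilon> * d t" and "q = t - r"
  have "0 \<le> t"
    using assms r_nonneg \<epsilon>_nonneg by linarith
  have d: "\<bar>\<epsilon> * d t\<bar> \<le> \<epsilon>"
    using d_bound[OF \<open>0 \<le> t\<close>] \<epsilon>_nonneg by (simp add: abs_mult mult_left_le)
  then have nonneg: "0 \<le> p" "0 \<le> q"
    using assms \<epsilon>_nonneg by (auto simp: p_def q_def abs_le_iff)
  have "u (t - r - \<epsilon> * d t) = k (z p)" "u (t - r) = k (z q)"
    using u_eq nonneg by (simp_all add: p_def q_def)
  then have "v t = endo_apply (exp (r *\<^sub>R \<alpha>) * Endo (B o\<^sub>L k)) (z p - z q)"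
    by (simp add: v_def blinfun.diff_right)
  then have "norm (v t) \<le> norm (exp (r *\<^sub>R \<alpha>) * Endo (B o\<^sub>L k)) * norm (z p - z q)"
    by (simp only: norm_endo_apply_le)
  moreover have "norm (z p - z q) = norm (z (max p q) - z (min p q))"
    by (simp add: max_def min_def norm_minus_commute)
  moreover have "0 \<le> min p q" "t - (r + \<epsilon>) \<le> min p q" "min p q \<le> max p q" "max p q \<le> t" "max p q - min p q \<le> \<epsilon>"
    using nonneg d r_nonneg \<epsilon>_nonneg \<epsilon>_le_r by (auto simp: p_def q_def abs_le_iff max_def min_def)
  ultimately show ?thesis
    by metis
qed

text \<open>Replaces Gronwall's inequality: in the norm weighted by $e^{-ct}$ the perturbation has gain at most
  one half, once $c$ is large.\<close>

lemma norm_z_le_growth: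
  assumes \<Theta>: "0 \<le> \<Theta>" "0 < l" "\<And>t. 0 \<le> t \<Longrightarrow> norm (exp (t *\<^sub>R M)) \<le> \<Theta> * exp (- l * t)"
    and N: "\<And>s. s \<in> {- r - \<epsilon>..0} \<Longrightarrow> norm (u s) \<le> N"
    and c: "c = 4 * (norm (exp (r *\<^sub>R \<alpha>)) * norm B) * \<Theta> * (norm k + 1)"
    and "0 \<le> t"
  shows "norm (z t) \<le> exp (c * t) * (2 * \<Theta> * norm (z 0) + N)"
proof -
  define H where "H = norm (exp (r *\<^sub>R \<alpha>)) * norm B"
  have "0 \<le> H"
    by (simp add: H_def)
  have "0 \<le> c"
    using \<Theta>(1) by (simp add: c)
  have "0 \<le> N"
    using order.trans[OF norm_ge_zero N[of 0]] r_nonneg \<epsilon>_nonneg by simp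
  define \<phi> where "\<phi> s = exp (- c * s) * norm (z s)" for s
  have "\<phi> t \<le> (\<Theta> * norm (z 0) + N / 2) / (1 - 1 / 2)"
  proof (rule bounded_function_le_of_contractive_bound[where S = "{0..t}" and \<phi> = \<phi>])
    obtain C where C: "\<And>s. s \<in> {0..t} \<Longrightarrow> norm (z s) \<le> C"
      using z_bounded[of t] unfolding bounded_iff by blast
    show "bdd_above (\<phi> ` {0..t})"
    proof (rule bdd_aboveI2)
      show "\<phi> s \<le> 1 * C" if "s \<in> {0..t}" for s
        unfolding \<phi>_def using that C[OF that] \<open>0 \<le> c\<close>
        by (intro mult_mono) auto
    qed
    fix Y s assume le: "\<And>s. s \<in> {0..t} \<Longrightarrow> \<phi> s \<le> Y" and s: "s \<in> {0..t}"
    have Y: "norm (z q) \<le> Y * exp (c * q)" if "q \<in> {0..t}" for q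
      using le[OF that] by (simp add: \<phi>_def exp_minus field_simps)
    have "0 \<le> \<phi> 0"
      by (simp add: \<phi>_def)
    also have "\<phi> 0 \<le> Y"
      using le \<open>0 \<le> t\<close> by simp
    finally have "0 \<le> Y" .
    \<comment> \<open>The constant covers the prescribed segment by \<open>N\<close> and the
      feedback by \<open>norm k * Y\<close>; the growing weight may be taken at the later time
      \<open>p\<close>.\<close>
    have u_le: "norm (u q) \<le> (N + norm k * Y) * exp (c * p)" if "q \<in> {- r - \<epsilon>..p}" "p \<in> {0..t}" for p q
    proof (cases "q \<le> 0")
      case True
      then have "norm (u q) \<le> N * 1"
        using that N by simp
      also have "\<dots> \<le> (N + norm k * Y) * exp (c * p)"
        using \<open>0 \<le> N\<close> \<open>0 \<le> Y\<close> \<open>0 \<le> c\<close> that by (intro mult_mono) auto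
      finally show ?thesis .
    next
      case False
      then have "norm (u q) \<le> norm k * norm (z q)"
        using u_eq[of q] norm_blinfun by simp
      also have "\<dots> \<le> norm k * (Y * exp (c * p))"
        using False that \<open>0 \<le> c\<close> \<open>0 \<le> Y\<close>
        by (intro mult_left_mono order.trans[OF Y]) (auto intro: mult_left_mono)
      also have "\<dots> \<le> (N + norm k * Y) * exp (c * p)"
        using \<open>0 \<le> N\<close> by (simp add: algebra_simps)
      finally show ?thesis .
    qed
    \<comment> \<open>The double sign matches \<open>state_le\<close> at the rate
      \<open>- c\<close>.\<close>
    have v_le: "norm (v p) \<le> 2 * H * (N + norm k * Y) * exp (- (- c) * p)" if "p \<in> {0..s}" for p
    proof -
      have "norm (v p) \<le> H * (2 * ((N + norm k * Y) * exp (c * p)))"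
        unfolding H_def using that s by (intro norm_v_le u_le) auto
      then show ?thesis
        by (simp add: algebra_simps)
    qed
    have "norm (z s) \<le> exp (- (- c) * s) * (\<Theta> * norm (z 0) + \<Theta> * (2 * H * (N + norm k * Y)) / (l - - c))"
      using s \<open>0 \<le> c\<close> by (intro state_le[OF \<Theta>(1,3) variation_of_constants] v_le) (use \<Theta>(2) in auto)
    \<comment> \<open>Here the choice of \<open>c\<close> pays off: already without \<open>l\<close>
      in the denominator the gain from \<open>Y\<close> is at most one half.\<close>
    also have "\<Theta> * (2 * H * (N + norm k * Y)) / (l - - c) \<le> (N + Y) / 2"
    proof -
      have c_eq: "c = 4 * H * \<Theta> * (norm k + 1)"
        by (simp add: c H_def)
      have "\<Theta> * (2 * H * (N + norm k * Y)) * 2 \<le> c * (N + Y)"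
        using \<Theta>(1) \<open>0 \<le> H\<close> \<open>0 \<le> N\<close> \<open>0 \<le> Y\<close> by (simp add: c_eq algebra_simps)
      also have "\<dots> \<le> (l + c) * (N + Y)"
        using \<Theta>(2) \<open>0 \<le> N\<close> \<open>0 \<le> Y\<close> by (intro mult_right_mono) auto
      finally show ?thesis
        using \<Theta>(2) \<open>0 \<le> c\<close> by (simp add: field_simps)
    qed
    finally have "norm (z s) \<le> exp (c * s) * (\<Theta> * norm (z 0) + (N + Y) / 2)"
      by simp
    then show "\<phi> s \<le> \<Theta> * norm (z 0) + N / 2 + 1 / 2 * Y"
      by (simp add: \<phi>_def exp_minus field_simps)
  qed (use \<open>0 \<le> t\<close> in auto)
  then show ?thesis
    by (simp add: \<phi>_def exp_minus field_simps)
qed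

end

text \<open>The growth bound controls \<open>v\<close> up to time \<open>r + \<epsilon>\<close>, the
  small-gain estimate makes it decay afterwards, and the decay passes to \<open>z\<close>, then to
  \<open>u\<close>, then to \<open>x\<close>. All constants are fixed before \<open>d\<close>,
  \<open>x\<close> and \<open>u\<close>, so the estimate is uniform in them.\<close>

theorem predictor_feedback_exponentially_stable:
  fixes \<alpha> :: "'a::{banach, perfect_space} endo" and B :: "'b::real_normed_vector \<Rightarrow>\<^sub>L 'a" and k :: "'a \<Rightarrow>\<^sub>L 'b"
  assumes "0 \<le> \<epsilon>" "\<epsilon> \<le> r" and \<Theta>: "0 \<le> \<Theta>" "0 < l"
    and decay: "\<And>t. 0 \<le> t \<Longrightarrow> norm (exp (t *\<^sub>R (\<alpha> + Endo (B o\<^sub>L k)))) \<le> \<Theta> * exp (- l * t)"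
    and kappa: "\<And>t. \<lbrakk>0 \<le> t; t \<le> \<epsilon>\<rbrakk> \<Longrightarrow> norm (exp (t *\<^sub>R (\<alpha> + Endo (B o\<^sub>L k))) - 1) \<le> \<kappa>"
    and gain: "\<Theta> * norm (exp (r *\<^sub>R \<alpha>) * Endo (B o\<^sub>L k)) * (\<kappa> + 1 - exp (- l * \<epsilon>)) < l"
  obtains Q \<sigma> where "Q > 0" "\<sigma> > 0"
    "\<And>d x u N s t. \<lbrakk>predictor_feedback \<alpha> B k r \<epsilon> d x u; \<And>s. s \<in> {- r - \<epsilon>..0} \<Longrightarrow> norm (u s) \<le> N;
       0 \<le> t; s \<in> {t - r - \<epsilon>..t}\<rbrakk>
       \<Longrightarrow> norm (x t) + norm (u s) \<le> Q * exp (- \<sigma> * t) * (norm (x 0) + N)"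
proof -
  define \<gamma> where "\<gamma> = norm (exp (r *\<^sub>R \<alpha>) * Endo (B o\<^sub>L k))"
  have "0 \<le> r" "0 \<le> \<gamma>"
    using assms(1,2) by (auto simp: \<gamma>_def)
  have "0 \<le> \<kappa>"
    using order.trans[OF norm_ge_zero kappa[of 0]] \<open>0 \<le> \<epsilon>\<close> by simp
  have "\<gamma> * \<Theta> * (\<kappa> + 1 - exp (- l * \<epsilon>)) < l"
    using gain by (simp add: \<gamma>_def mult_ac)
  then obtain \<sigma> where \<sigma>: "0 < \<sigma>" "\<sigma> < l"
    "exp (\<sigma> * (r + \<epsilon>)) * (\<gamma> * \<Theta> * (\<kappa> + 1 - exp (- (l - \<sigma>) * \<epsilon>)) / (l - \<sigma>)) < 1"
    using exists_decay_rate[OF \<Theta>(2)] by blast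
  define \<rho> where "\<rho> = exp (\<sigma> * (r + \<epsilon>)) * (\<gamma> * \<Theta> * (\<kappa> + 1 - exp (- (l - \<sigma>) * \<epsilon>)) / (l - \<sigma>))"
  \<comment> \<open>Constants relative to the size \<open>S\<close> of the initial data:
    \<open>Z0\<close> bounds \<open>z 0\<close>; \<open>G\<close> and \<open>D\<close> bound
    \<open>z\<close> and \<open>v\<close> up to a given time; \<open>V\<close>, \<open>Z\<close>,
    \<open>U\<close>, \<open>X\<close> are the decay constants of \<open>v\<close>,
    \<open>z\<close>, \<open>u\<close>, \<open>x\<close>.\<close>
  define H where "H = norm (exp (r *\<^sub>R \<alpha>)) * norm B"
  define c where "c = 4 * H * \<Theta> * (norm k + 1)"
  define J where "J = r * exp (r * norm \<alpha>) * norm B"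
  define Z0 where "Z0 = norm (exp (r *\<^sub>R \<alpha>)) + J"
  define G where "G t = exp (c * t) * (2 * \<Theta> * Z0 + 1)" for t
  define D where "D t = H * (2 * ((1 + norm k) * G t))" for t
  define V where "V = exp (\<sigma> * (r + \<epsilon>)) * (D (r + \<epsilon>) + \<gamma> * \<kappa> * \<Theta> * Z0) / (1 - \<rho>)"
  define Z where "Z = \<Theta> * Z0 + \<Theta> * V / (l - \<sigma>)"
  \<comment> \<open>The \<open>+ 1\<close> covers the initial segment, where \<open>u\<close> is
    prescribed, and makes \<open>Q\<close> positive.\<close>
  define U where "U = norm k * Z + 1"
  define X where "X = norm (exp (- r *\<^sub>R \<alpha>)) * (Z + J * (U * exp (\<sigma> * r)))"
  define Q where "Q = X + U * exp (\<sigma> * (r + \<epsilon>))"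
  have nonneg: "0 \<le> H" "0 \<le> c" "0 \<le> J" "0 \<le> Z0"
    using \<open>0 \<le> r\<close> \<Theta>(1) by (simp_all add: H_def c_def J_def Z0_def)
  have "0 \<le> G t" for t
    using \<Theta>(1) nonneg by (simp add: G_def)
  then have "0 \<le> D t" for t
    using nonneg by (simp add: D_def)
  then have "0 \<le> V"
    unfolding V_def using \<Theta>(1) \<open>0 \<le> \<gamma>\<close> \<open>0 \<le> \<kappa>\<close> nonneg \<sigma>(3)
    by (intro divide_nonneg_pos mult_nonneg_nonneg add_nonneg_nonneg) (auto simp: \<rho>_def)
  then have "0 \<le> Z"
    using \<Theta>(1) nonneg \<sigma>(2) by (simp add: Z_def)
  then have "0 < U"
    by (simp add: U_def add_nonneg_pos)
  have "0 \<le> X"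
    using \<open>0 < U\<close> \<open>0 \<le> Z\<close> nonneg by (simp add: X_def)
  then have "0 < Q"
    using \<open>0 < U\<close> by (simp add: Q_def add_nonneg_pos)
  show thesis
  proof (rule that[OF \<open>0 < Q\<close> \<sigma>(1)])
    fix d x u N s t
    assume "predictor_feedback \<alpha> B k r \<epsilon> d x u" and N: "\<And>s. s \<in> {- r - \<epsilon>..0} \<Longrightarrow> norm (u s) \<le> N"
      and "0 \<le> t" and s: "s \<in> {t - r - \<epsilon>..t}"
    then interpret predictor_feedback \<alpha> B k r \<epsilon> d x u
      by simp
    have decay': "norm (exp (t *\<^sub>R M)) \<le> \<Theta> * exp (- l * t)" if "0 \<le> t" for t
      unfolding M_def using decay that .
    have kappa': "norm (exp (t *\<^sub>R M) - 1) \<le> \<kappa>" if "0 \<le> t" "t \<le> \<epsilon>" for t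
      unfolding M_def using kappa that .
    define S where "S = norm (x 0) + N"
    have "0 \<le> N"
      using order.trans[OF norm_ge_zero N[of 0]] r_nonneg \<epsilon>_nonneg by simp
    then have S: "N \<le> S" "norm (x 0) \<le> S" "0 \<le> S"
      by (simp_all add: S_def)
    have z0: "norm (z 0) \<le> Z0 * S"
    proof -
      have "norm (z 0) \<le> norm (endo_apply (exp (r *\<^sub>R \<alpha>)) (x 0)) + norm (z 0 - endo_apply (exp (r *\<^sub>R \<alpha>)) (x 0))"
        by (rule norm_triangle_sub)
      also have "\<dots> \<le> norm (exp (r *\<^sub>R \<alpha>)) * S + J * S"
        unfolding J_def using S N \<epsilon>_nonneg
        by (intro add_mono order.trans[OF norm_endo_apply_le] mult_left_mono norm_z_minus_le)
          (auto intro: order.trans[OF N])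
      finally show ?thesis
        by (simp add: Z0_def algebra_simps)
    qed
    have z_le: "norm (z t) \<le> G t * S" if "0 \<le> t" for t
    proof -
      have "norm (z t) \<le> exp (c * t) * (2 * \<Theta> * norm (z 0) + N)"
        using norm_z_le_growth[OF \<Theta> decay' N _ that] by (simp add: c_def H_def)
      also have "\<dots> \<le> exp (c * t) * (2 * \<Theta> * (Z0 * S) + S)"
        using z0 S \<Theta>(1) by (intro mult_left_mono add_mono) auto
      finally show ?thesis
        by (simp add: G_def algebra_simps)
    qed
    have G_mono: "G p \<le> G q" if "p \<le> q" for p q
      unfolding G_def using that nonneg \<Theta>(1) by (intro mult_right_mono) (auto intro: mult_left_mono)
    have G_ge_1: "1 \<le> G q" if "0 \<le> q" for q
    proof -
      have "1 * 1 \<le> G q"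
        unfolding G_def using that nonneg \<Theta>(1) by (intro mult_mono) auto
      then show ?thesis by simp
    qed
    have u_le: "norm (u p) \<le> (1 + norm k) * G q * S" if "p \<in> {- r - \<epsilon>..q}" "0 \<le> q" for p q
    proof (cases "p \<le> 0")
      case True
      then have "norm (u p) \<le> 1 * 1 * S"
        using that S(1) by (auto intro: order.trans[OF N])
      also have "\<dots> \<le> (1 + norm k) * G q * S"
        using G_ge_1[OF that(2)] S(3) by (intro mult_mono mult_right_mono) auto
      finally show ?thesis .
    next
      case False
      then have "norm (u p) \<le> norm k * norm (z p)"
        using u_eq[of p] norm_blinfun by simp
      also have "\<dots> \<le> norm k * (G q * S)"
        using False G_mono[of p q] that S(3) by (intro mult_left_mono order.trans[OF z_le] mult_right_mono) auto
      also have "\<dots> \<le> (1 + norm k) * G q * S"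
        using \<open>0 \<le> G q\<close> S(3) by (simp add: algebra_simps)
      finally show ?thesis .
    qed
    have v_le: "norm (v p) \<le> D q * S" if "0 \<le> p" "p \<le> q" for p q
    proof -
      have "norm (v p) \<le> norm (exp (r *\<^sub>R \<alpha>)) * norm B * (2 * ((1 + norm k) * G q * S))"
        using that by (intro norm_v_le u_le) auto
      then show ?thesis
        by (simp add: D_def H_def mult_ac)
    qed
    have v_decay: "norm (v t) \<le> V * S * exp (- \<sigma> * t)" if "0 \<le> t" for t
    proof -
      have "norm (v t) \<le> exp (\<sigma> * (r + \<epsilon>)) * (D (r + \<epsilon>) * S + \<gamma> * \<kappa> * \<Theta> * norm (z 0)) / (1 - \<rho>) * exp (- \<sigma> * t)"
      proof (rule small_gain[OF \<Theta>(1) decay' variation_of_constants kappa',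
            where h = "r + \<epsilon>" and \<gamma> = \<gamma> and D = "D (r + \<epsilon>) * S"])
        show "\<exists>a b. 0 \<le> a \<and> p - (r + \<epsilon>) \<le> a \<and> a \<le> b \<and> b \<le> p \<and> b - a \<le> \<epsilon> \<and>
            norm (v p) \<le> \<gamma> * norm (z b - z a)" if "r + \<epsilon> \<le> p" for p
          unfolding \<gamma>_def by (rule norm_v_le_diff[OF that])
        show "\<rho> < 1"
          using \<sigma>(3) by (simp only: \<rho>_def)
        show "bounded (v ` {0..\<tau>})" for \<tau>
          unfolding bounded_iff using v_le by (intro exI[of _ "D \<tau> * S"]) auto
      qed (use v_le \<sigma>(1,2) that \<epsilon>_nonneg r_nonneg \<open>0 \<le> \<gamma>\<close> in \<open>auto simp only: \<rho>_def atLeastAtMost_iff\<close>)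
      also have "\<dots> \<le> exp (\<sigma> * (r + \<epsilon>)) * (D (r + \<epsilon>) * S + \<gamma> * \<kappa> * \<Theta> * (Z0 * S)) / (1 - \<rho>) * exp (- \<sigma> * t)"
        using z0 \<Theta>(1) \<open>0 \<le> \<gamma>\<close> \<open>0 \<le> \<kappa>\<close> \<sigma>(3)
        by (intro mult_right_mono divide_right_mono mult_left_mono add_left_mono) (auto simp: \<rho>_def)
      also have "\<dots> = V * S * exp (- \<sigma> * t)"
        by (simp add: V_def algebra_simps)
      finally show ?thesis .
    qed
    have z_decay: "norm (z t) \<le> Z * S * exp (- \<sigma> * t)" if "0 \<le> t" for t
    proof -
      have "norm (z t) \<le> exp (- \<sigma> * t) * (\<Theta> * norm (z 0) + \<Theta> * (V * S) / (l - \<sigma>))"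
        using that \<sigma>(2) by (intro state_le[OF \<Theta>(1) decay' variation_of_constants] v_decay) auto
      also have "\<dots> \<le> exp (- \<sigma> * t) * (\<Theta> * (Z0 * S) + \<Theta> * (V * S) / (l - \<sigma>))"
        using z0 \<Theta>(1) by (intro mult_left_mono add_right_mono) auto
      finally show ?thesis
        by (simp add: Z_def algebra_simps)
    qed
    have u_decay: "norm (u p) \<le> U * S * exp (- \<sigma> * p)" if "- r - \<epsilon> \<le> p" for p
    proof (cases "p \<le> 0")
      case True
      then have "norm (u p) \<le> 1 * S * 1"
        using that S(1) by (auto intro: order.trans[OF N])
      also have "\<dots> \<le> U * S * exp (- \<sigma> * p)"
        using \<open>0 \<le> Z\<close> S(3) True \<sigma>(1) by (intro mult_mono) (auto simp: U_def mult_nonneg_nonpos)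
      finally show ?thesis .
    next
      case False
      then have "norm (u p) \<le> norm k * norm (z p)"
        using u_eq[of p] norm_blinfun by simp
      also have "\<dots> \<le> norm k * (Z * S * exp (- \<sigma> * p))"
        using False by (intro mult_left_mono z_decay) auto
      also have "\<dots> \<le> U * S * exp (- \<sigma> * p)"
        using S(3) by (simp add: U_def algebra_simps)
      finally show ?thesis .
    qed
    \<comment> \<open>Reading \<open>u\<close> up to \<tau> before \<open>t\<close> costs the factor
      \<open>exp (\<sigma> * \<tau>)\<close>. The case \<open>\<tau> = r\<close> serves the integral
      in \<open>z\<close>, the case \<open>\<tau> = r + \<epsilon>\<close> the final
      supremum.\<close>
    have u_decay': "norm (u p) \<le> U * S * (exp (\<sigma> * \<tau>) * exp (- \<sigma> * t))"
      if "t - \<tau> \<le> p" "\<tau> \<le> r + \<epsilon>" for p \<tau>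
    proof -
      have "norm (u p) \<le> U * S * exp (- \<sigma> * p)"
        using that \<open>0 \<le> t\<close> by (intro u_decay) auto
      also have "\<dots> \<le> U * S * exp (\<sigma> * \<tau> + - \<sigma> * t)"
      proof -
        have "\<sigma> * (t - \<tau>) \<le> \<sigma> * p"
          using that \<sigma>(1) by (intro mult_left_mono) auto
        then show ?thesis
          using \<open>0 < U\<close> S(3) by (intro mult_left_mono) (auto simp: algebra_simps)
      qed
      finally show ?thesis
        by (simp only: exp_add)
    qed
    have "norm (x t) \<le> X * S * exp (- \<sigma> * t)"
    proof -
      let ?R = "endo_apply (exp (r *\<^sub>R \<alpha>))"
      have "norm (?R (x t)) \<le> norm (z t) + norm (z t - ?R (x t))"
        by (metis norm_minus_commute norm_triangle_sub)
      also have "\<dots> \<le> Z * S * exp (- \<sigma> * t) + J * (U * S * (exp (\<sigma> * r) * exp (- \<sigma> * t)))"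
        unfolding J_def using \<open>0 \<le> t\<close> \<epsilon>_nonneg by (intro add_mono z_decay norm_z_minus_le u_decay') auto
      finally have le: "norm (?R (x t)) \<le> Z * S * exp (- \<sigma> * t) + J * (U * S * (exp (\<sigma> * r) * exp (- \<sigma> * t)))" .
      \<comment> \<open>The exponential is invertible, so a bound on the predicted part of
        \<open>z\<close> is a bound on \<open>x\<close>.\<close>
      have "x t = endo_apply (exp (- r *\<^sub>R \<alpha>)) (?R (x t))"
        using exp_minus_inverse[of "- (r *\<^sub>R \<alpha>)"] by (simp flip: endo_apply_times)
      then have "norm (x t) \<le> norm (exp (- r *\<^sub>R \<alpha>)) * norm (?R (x t))"
        by (metis norm_endo_apply_le)
      also have "\<dots> \<le> norm (exp (- r *\<^sub>R \<alpha>)) * (Z * S * exp (- \<sigma> * t) + J * (U * S * (exp (\<sigma> * r) * exp (- \<sigma> * t))))"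
        by (intro mult_left_mono le) auto
      finally show ?thesis
        by (simp add: X_def algebra_simps)
    qed
    moreover have "norm (u s) \<le> U * S * (exp (\<sigma> * (r + \<epsilon>)) * exp (- \<sigma> * t))"
      using s by (intro u_decay') auto
    ultimately show "norm (x t) + norm (u s) \<le> Q * exp (- \<sigma> * t) * (norm (x 0) + N)"
      unfolding S_def[symmetric] by (simp add: Q_def algebra_simps)
  qed
qed

section \<open>Translation to the matrix system\<close>

lemma closed_loop_solution_imp_predictor_feedback:
  assumes "0 \<le> \<epsilon>" "\<epsilon> \<le> r" and d: "d \<in> Linfty {0..} {-1..1}" and sol: "closed_loop_solution A B k r \<epsilon> d x u"
  shows "predictor_feedback (endo_of_matrix A) (Blinfun ((*v) B)) (Blinfun ((*v) k)) r \<epsilon> d x u"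
proof -
  have [simp]: "blinfun_apply (Blinfun ((*v) C)) = (*v) C" for C :: "real ^ 'c ^ 'd"
    by (simp add: bounded_linear_Blinfun_apply matrix_vector_mul_bounded_linear)
  show ?thesis
  proof
    show "\<bar>d t\<bar> \<le> 1" if "0 \<le> t" for t
      using d that by (auto simp: Linfty_def abs_le_iff)
    show "abs_continuous_on {0..b} x" for b
    proof -
      \<comment> \<open>Local absolute continuity concerns only ordered end points, whereas
        \<open>b\<close> may be negative.\<close>
      have "abs_continuous_on {0..\<bar>b\<bar>} x"
        using sol unfolding closed_loop_solution_def locally_abs_continuous_on_def
        by (metis Icc_subset_Ici_iff abs_ge_zero order_refl)
      then show ?thesis
        by (rule abs_continuous_on_subset) auto
    qed
    show "u t = Blinfun ((*v) k) (endo_apply (exp (r *\<^sub>R endo_of_matrix A)) (x t) + integral {t..t + r}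
        (\<lambda>s. endo_apply (exp ((t + r - s) *\<^sub>R endo_of_matrix A)) (Blinfun ((*v) B) (u (s - r)))))"
      if "0 \<le> t" for t
      using sol that
      by (simp add: closed_loop_solution_def matexp_mult_vector matrix_vector_right_distrib flip: matrix_vector_mul_assoc)
  qed (use assms sol in \<open>auto simp: closed_loop_solution_def\<close>)
qed

text \<open>\<kappa> stays open because the two criteria of the theorem use different bounds for it,
  together with different \<Theta> and \<open>l\<close>.\<close>

lemma exponential_estimate_of_small_gain:
  fixes A :: "real ^ 'n ^ 'n" and B :: "real ^ 'm ^ 'n" and k :: "real ^ 'n ^ 'm"
  assumes "0 \<le> \<epsilon>" "\<epsilon> \<le> r" "0 \<le> \<Theta>" "0 < l"
    and decay: "\<And>t. 0 \<le> t \<Longrightarrow> norm (exp (t *\<^sub>R endo_of_matrix (A + B ** k))) \<le> \<Theta> * exp (- l * t)"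
    and kappa: "\<And>t. \<lbrakk>0 \<le> t; t \<le> \<epsilon>\<rbrakk> \<Longrightarrow> norm (exp (t *\<^sub>R endo_of_matrix (A + B ** k)) - 1) \<le> \<kappa>"
    and gain: "\<Theta> * opnorm (matexp (r *\<^sub>R A) ** B ** k) * (\<kappa> + 1 - exp (- l * \<epsilon>)) < l"
  shows "\<exists>Q>0. \<exists>\<sigma>>0. exponential_estimate A B k r \<epsilon> Q \<sigma>"
proof -
  define B' k' where "B' = Blinfun ((*v) B)" and "k' = Blinfun ((*v) k)"
  have Bk: "Endo (B' o\<^sub>L k') = endo_of_matrix (B ** k)"
    by (rule endo_eqI)
      (simp add: B'_def k'_def bounded_linear_Blinfun_apply matrix_vector_mul_bounded_linear matrix_vector_mul_assoc)
  have M: "endo_of_matrix A + Endo (B' o\<^sub>L k') = endo_of_matrix (A + B ** k)"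
    by (simp add: Bk endo_of_matrix_add)
  have "norm (exp (r *\<^sub>R endo_of_matrix A) * Endo (B' o\<^sub>L k')) = opnorm (matexp (r *\<^sub>R A) ** B ** k)"
    by (simp add: Bk norm_endo_of_matrix endo_of_matrix_matexp endo_of_matrix_scaleR
        flip: endo_of_matrix_mult matrix_mul_assoc)
      (simp add: endo_of_matrix_mult endo_of_matrix_matexp endo_of_matrix_scaleR flip: norm_endo_of_matrix)
  with gain have gain': "\<Theta> * norm (exp (r *\<^sub>R endo_of_matrix A) * Endo (B' o\<^sub>L k')) * (\<kappa> + 1 - exp (- l * \<epsilon>)) < l"
    by simp
  obtain Q \<sigma> where Q: "Q > 0" "\<sigma> > 0"
    "\<And>d x u N s t. \<lbrakk>predictor_feedback (endo_of_matrix A) B' k' r \<epsilon> d x u; \<And>s. s \<in> {- r - \<epsilon>..0} \<Longrightarrow> norm (u s) \<le> N;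
       0 \<le> t; s \<in> {t - r - \<epsilon>..t}\<rbrakk>
       \<Longrightarrow> norm (x t) + norm (u s) \<le> Q * exp (- \<sigma> * t) * (norm (x 0) + N)"
    by (rule predictor_feedback_exponentially_stable[OF assms(1-4) decay[folded M] kappa[folded M] gain']) blast+
  have "exponential_estimate A B k r \<epsilon> Q \<sigma>"
    unfolding exponential_estimate_def
  proof (intro ballI allI impI, elim conjE)
    fix d x0 u0 x u and t :: real
    assume d: "d \<in> Linfty {0..} {-1..1}" and u0: "continuous_on {- r - \<epsilon>..0} u0"
      and sol: "closed_loop_solution A B k r \<epsilon> d x u" and "x 0 = x0"
      and u: "\<forall>t\<in>{- r - \<epsilon>..0}. u t = u0 t" and "0 \<le> t"
    define N where "N = (SUP s\<in>{- \<epsilon> - r..0}. norm (u0 s))"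
    have "bdd_above ((\<lambda>s. norm (u0 s)) ` {- \<epsilon> - r..0})"
      using u0 by (intro bounded_imp_bdd_above compact_imp_bounded compact_continuous_image continuous_on_norm)
        (simp_all add: minus_diff_commute[of \<epsilon> r])
    then have "norm (u s) \<le> N" if "s \<in> {- r - \<epsilon>..0}" for s
      unfolding N_def using u that cSUP_upper[of s "{- \<epsilon> - r..0}" "\<lambda>s. norm (u0 s)"] by auto
    then have le: "norm (x t) + norm (u s) \<le> Q * exp (- \<sigma> * t) * (norm x0 + N)" if "s \<in> {t - \<epsilon> - r..t}" for s
      using Q(3) closed_loop_solution_imp_predictor_feedback[OF assms(1,2) d sol] \<open>0 \<le> t\<close> \<open>x 0 = x0\<close> that
      by (auto simp: B'_def k'_def)
    \<comment> \<open>As \<open>x t\<close> does not depend on \<open>s\<close>, it is moved to the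
      right and the pointwise bound passes to the supremum.\<close>
    have "(SUP s\<in>{t - \<epsilon> - r..t}. norm (u s)) \<le> Q * exp (- \<sigma> * t) * (norm x0 + N) - norm (x t)"
    proof (rule cSUP_least)
      show "{t - \<epsilon> - r..t} \<noteq> {}"
        using assms(1,2) by simp
      show "norm (u s) \<le> Q * exp (- \<sigma> * t) * (norm x0 + N) - norm (x t)" if "s \<in> {t - \<epsilon> - r..t}" for s
        using le[OF that] by linarith
    qed
    then show "norm (x t) + (SUP s\<in>{t - \<epsilon> - r..t}. norm (u s)) \<le>
        Q * exp (- \<sigma> * t) * (norm x0 + (SUP s\<in>{- \<epsilon> - r..0}. norm (u0 s)))"
      by (simp add: N_def)
  qed
  with Q(1,2) show ?thesis
    by blast
qed

section \<open>The one-dimensional case\<close>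

lemma matrix_eq_mat_of_card_1:
  fixes M :: "real ^ 'n ^ 'n"
  assumes "CARD('n) = 1"
  shows "M = mat (M $ i $ i)"
proof -
  have eq: "p = i" for p :: 'n
    using assms by (metis (full_types) UNIV_I card_1_singletonE singletonD)
  show ?thesis
    by (simp add: vec_eq_iff mat_def) (metis eq)
qed

text \<open>Every nonzero vector, for instance \<open>1\<close>, is an eigenvector of a scalar
  matrix for its only eigenvalue \<open>c\<close>.\<close>

lemma hurwitz_mat_iff: "hurwitz (mat c :: real ^ 'n ^ 'n) \<longleftrightarrow> c < 0"
proof -
  have "map_matrix complex_of_real (mat c :: real ^ 'n ^ 'n) = mat (complex_of_real c)"
    by (simp add: map_matrix_def mat_def vec_eq_iff)
  moreover have "mat w *v v = w *s v" for w :: complex and v :: "complex ^ 'n"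
    by (simp add: mat_def matrix_vector_mult_def vec_eq_iff if_distrib if_distribR cong: if_cong)
  moreover have "(1 :: complex ^ 'n) \<noteq> 0"
    by simp
  ultimately show ?thesis
    unfolding hurwitz_def by (metis Re_complex_of_real vector_mul_rcancel)
qed

theorem theorem2p1:
  fixes A :: "real ^ 'n ^ 'n" and B :: "real ^ 'm ^ 'n" and k :: "real ^ 'n ^ 'm"
    and r \<epsilon> \<Theta> lam :: real
  assumes "0 < \<epsilon>" and "\<epsilon> \<le> r"
    and "hurwitz (A + B ** k)"
    and "\<Theta> > 0" and "lam > 0"
    and "\<And>t. t \<ge> 0 \<Longrightarrow> opnorm (matexp (t *\<^sub>R (A + B ** k))) \<le> \<Theta> * exp (- lam * t)"
  shows "(\<Theta> * opnorm (matexp (r *\<^sub>R A) ** B ** k) *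
            (exp (opnorm (A + B ** k) * \<epsilon>) - exp (- lam * \<epsilon>)) < lam
          \<longrightarrow> (\<exists>Q>0. \<exists>\<sigma>>0. exponential_estimate A B k r \<epsilon> Q \<sigma>)) \<and>
         (CARD('n) = 1 \<longrightarrow>
          (\<forall>i. 2 * opnorm (B ** k) * matexp (r *\<^sub>R A) $ i $ i *
                 (1 - exp (- opnorm (A + B ** k) * \<epsilon>)) < opnorm (A + B ** k))
          \<longrightarrow> (\<exists>Q>0. \<exists>\<sigma>>0. exponential_estimate A B k r \<epsilon> Q \<sigma>))"
proof (intro conjI impI)
  let ?M = "endo_of_matrix (A + B ** k)"
  assume gain: "\<Theta> * opnorm (matexp (r *\<^sub>R A) ** B ** k) *
    (exp (opnorm (A + B ** k) * \<epsilon>) - exp (- lam * \<epsilon>)) < lam"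
  show "\<exists>Q>0. \<exists>\<sigma>>0. exponential_estimate A B k r \<epsilon> Q \<sigma>"
  \<comment> \<open>With this \<kappa>, the term \<open>\<kappa> + 1\<close> is exactly the first
    exponential of the hypothesis.\<close>
  proof (rule exponential_estimate_of_small_gain[where \<Theta> = \<Theta> and l = lam and \<kappa> = "exp (opnorm (A + B ** k) * \<epsilon>) - 1"])
    show "norm (exp (t *\<^sub>R ?M)) \<le> \<Theta> * exp (- lam * t)" if "0 \<le> t" for t
      using assms(6)[OF that] by (simp flip: norm_endo_of_matrix add: endo_of_matrix_matexp endo_of_matrix_scaleR)
    show "norm (exp (t *\<^sub>R ?M) - 1) \<le> exp (opnorm (A + B ** k) * \<epsilon>) - 1" if "0 \<le> t" "t \<le> \<epsilon>" for t
    proof -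
      have "norm (t *\<^sub>R ?M) \<le> opnorm (A + B ** k) * \<epsilon>"
        using that by (simp add: mult_right_mono mult.commute[of _ \<epsilon>] flip: norm_endo_of_matrix)
      then show ?thesis
        using norm_exp_minus_one_le[of "t *\<^sub>R ?M"] by (meson diff_right_mono exp_le_cancel_iff order.trans)
    qed
  qed (use assms gain in auto)
next
  assume card: "CARD('n) = 1"
    and gain: "\<forall>i. 2 * opnorm (B ** k) * matexp (r *\<^sub>R A) $ i $ i *
      (1 - exp (- opnorm (A + B ** k) * \<epsilon>)) < opnorm (A + B ** k)"
  fix i :: 'n
  \<comment> \<open>The Hurwitz condition makes the single entry negative, so \<mu> is at once the
    norm of \<open>A + B ** k\<close> and its exact decay rate, with overshoot 1.\<close>
  define \<mu> where "\<mu> = - (A + B ** k) $ i $ i"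
  have scalar: "C = mat (C $ i $ i)" for C :: "real ^ 'n ^ 'n"
    by (rule matrix_eq_mat_of_card_1[OF card])
  have M: "A + B ** k = mat (- \<mu>)"
    unfolding \<mu>_def minus_minus by (rule scalar)
  with assms(3) have "0 < \<mu>"
    by (simp add: hurwitz_mat_iff)
  have opnorm_mat: "opnorm (mat c :: real ^ 'n ^ 'n) = \<bar>c\<bar>" for c
    by (simp add: endo_of_matrix_mat flip: norm_endo_of_matrix)
  have exp_M: "exp (t *\<^sub>R endo_of_matrix (A + B ** k)) = of_real (exp (- \<mu> * t))" for t
    unfolding M by (rule exp_scaleR_endo_of_matrix_mat)
  define a where "a = A $ i $ i"
  have A: "A = mat a"
    unfolding a_def by (rule scalar)
  have "endo_of_matrix (matexp (r *\<^sub>R A)) = endo_of_matrix (mat (exp (a * r)))"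
    unfolding A endo_of_matrix_matexp endo_of_matrix_scaleR exp_scaleR_endo_of_matrix_mat
    by (rule endo_of_matrix_mat[symmetric])
  then have exp_A: "matexp (r *\<^sub>R A) = mat (exp (a * r))"
    by (simp add: endo_of_matrix_inj)
  have "opnorm (matexp (r *\<^sub>R A) ** B ** k) = exp (a * r) * opnorm (B ** k)"
  proof -
    have "endo_of_matrix (matexp (r *\<^sub>R A) ** (B ** k)) = exp (a * r) *\<^sub>R endo_of_matrix (B ** k)"
      unfolding exp_A endo_of_matrix_mult endo_of_matrix_mat by (simp only: scaleR_conv_of_real)
    then show ?thesis
      by (simp add: matrix_mul_assoc flip: norm_endo_of_matrix)
  qed
  moreover have "matexp (r *\<^sub>R A) $ i $ i = exp (a * r)"
    by (simp add: exp_A mat_def)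
  moreover have "opnorm (A + B ** k) = \<mu>"
    using \<open>0 < \<mu>\<close> by (simp add: M opnorm_mat)
  \<comment> \<open>With \<kappa> equal to \<open>1 - exp (- \<mu> * \<epsilon>)\<close> the bracket
    is twice that number, which explains the 2 in the scalar condition.\<close>
  ultimately have gain': "1 * opnorm (matexp (r *\<^sub>R A) ** B ** k) * ((1 - exp (- \<mu> * \<epsilon>)) + 1 - exp (- \<mu> * \<epsilon>)) < \<mu>"
    using gain[rule_format, of i] by (simp add: algebra_simps)
  show "\<exists>Q>0. \<exists>\<sigma>>0. exponential_estimate A B k r \<epsilon> Q \<sigma>"
  proof (rule exponential_estimate_of_small_gain[OF _ _ _ _ _ _ gain'])
    show "norm (exp (t *\<^sub>R endo_of_matrix (A + B ** k)) - 1) \<le> 1 - exp (- \<mu> * \<epsilon>)" if "0 \<le> t" "t \<le> \<epsilon>" for t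
    proof -
      have "norm (exp (t *\<^sub>R endo_of_matrix (A + B ** k)) - 1) = \<bar>exp (- \<mu> * t) - 1\<bar>"
        unfolding exp_M by (metis norm_of_real of_real_1 of_real_diff)
      also have "\<dots> \<le> 1 - exp (- \<mu> * \<epsilon>)"
        using that \<open>0 < \<mu>\<close> by (simp add: mult_left_mono)
      finally show ?thesis .
    qed
  qed (use assms \<open>0 < \<mu>\<close> in \<open>simp_all add: exp_M\<close>)
qed

end
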